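(* Fix $p\in[0,1]$ and set $x=p/2$, $y=1-p/2$, $q=1-p$. For $n\ge1$ let $\vec G(n,p)$ be the random directed graph on $[n]$ obtained by including each edge independently with probability $p$ and then orienting each included edge independently in either direction with probability $1/2$. For a vertex $v$, the out-cluster $\overrightarrow{C}_v$ is the set of vertices $u$ such that there is a directed path from $v$ to $u$, and the in-cluster $\overleftarrow{C}_v$ is the set of vertices $u$ such that there is a directed path from $u$ to $v$; by convention $v\in\overrightarrow{C}_v\cap\overleftarrow{C}_v$. For $s\in S\subseteq[n]$ with $|S|=k$ let $d_p(n,k)=\mathbb{P}(\overrightarrow{C}_s=S)$ (this depends only on $n,k$; $d_p(1,1)=1$). For $n\ge2$, distinct $a,t\in[n]$, $t\in T\subseteq[n]$, $a\in A\subseteq[n]$ with $|T|=\tau$, $|A|=\alpha$, $|[n]\setminus(A\cup T)|=r$, let $N_p(n,\tau,\alpha,r)=\mathbb{P}(\overrightarrow{C}_t=T,\ \overleftarrow{C}_a=A)$ (this depends only on $n,\tau,\alpha,r$; $N_p(2,2,2,0)=x$, $N_p(2,1,1,0)=y$), and write $j=\tau+\alpha-(n-r)=|A\cap T|$. Then, for $\tau,\alpha\ge1$ and $\tau+\alpha\ge n-r\ge\tau,\alpha$: (i) for $r>0$: $N_p(n,\tau,\alpha,r)=N_p(n-r,\tau,\alpha,0)\,q^{r(r+\tau+\alpha-n)}\,y^{r(2n-2r-\tau-\alpha)}$; (ii) $N_p(n,\tau,\alpha,r)=N_p(n,\alpha,\tau,r)$; (iii) for $n>\tau$, $n\ge\alpha\ge2$,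 $j\ge2$ (with $r=0$): $$N_p(n,\tau,\alpha,0)=\sum_{\zeta=1}^{n-\tau}\binom{n-\tau-1}{\zeta-1}N_p(n-\zeta,\tau,\alpha-\zeta,0)\,d_p(\zeta,\zeta)\,q^{(\zeta-1)(\alpha+\tau-n)}\,y^{(\zeta-1)(2n-\tau-\alpha-\zeta)}\left(y^{\tau}-y^{2n-\alpha-\tau-\zeta}q^{\alpha+\tau-n}\right);$$ (iv) for $\alpha\ge2$ and $j=0$, i.e. $n=\tau+\alpha$: $$N_p(n,\tau,\alpha,0)=\sum_{\zeta=1}^{\alpha-1}\binom{\alpha-2}{\zeta-1}N_p(n-\zeta,\tau,\alpha-\zeta,0)\,d_p(\zeta,\zeta)\,y^{(\zeta-1)(\tau+\alpha-\zeta)}\,y^{\tau}\left(1-y^{\alpha-\zeta}\right);$$ (v) $$N_p(n,n,n,0)=1-\sum_{j=2}^{n-1}\binom{n-2}{j-2}\sum_{\tau=j}^{n}\binom{n-j}{\tau-j}\sum_{\alpha=j}^{n-\tau+j}\binom{n-\tau}{\alpha-j}N_p(n,\tau,\alpha,n-\alpha-\tau+j)-\sum_{\tau=1}^{n}\binom{n-2}{\tau-1}\sum_{\alpha=1}^{n-\tau}\binom{n-\tau-1}{\alpha-1}N_p(n,\tau,\alpha,n-\alpha-\tau).$$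
   Context: Probabilities are in the joint space of the random graph and the random orientations. The value $j=1$ never occurs, since if $A\cap T\neq\emptyset$ then $a,t\in A\cap T$. *)

theory Defs
  imports "HOL-Probability.Probability"
begin

text \<open>
  The vertex set $[n]$ is \<open>{1..n}\<close>. An undirected edge is encoded as the pair of its end points in
  increasing order; a directed graph is a relation, \<open>(u, v)\<close> being the arc from \<open>u\<close> to \<open>v\<close>.
\<close>

definition all_edges :: "nat \<Rightarrow> (nat \<times> nat) set" where
  "all_edges n = {(u, v). 1 \<le> u \<and> u < v \<and> v \<le> n}"

definition random_graph :: "nat \<Rightarrow> real \<Rightarrow> (nat \<times> nat) set pmf" where
  "random_graph n p =
     map_pmf (\<lambda>f. {e \<in> all_edges n. f e}) (Pi_pmf (all_edges n) False (\<lambda>_. bernoulli_pmf p))"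

definition random_orientation :: "(nat \<times> nat) set \<Rightarrow> (nat \<times> nat) set pmf" where
  "random_orientation E =
     map_pmf (\<lambda>f. (\<lambda>(u, v). if f (u, v) then (u, v) else (v, u)) ` E)
       (Pi_pmf E False (\<lambda>_. bernoulli_pmf (1 / 2)))"

definition random_digraph :: "nat \<Rightarrow> real \<Rightarrow> (nat \<times> nat) set pmf" where
  "random_digraph n p = bind_pmf (random_graph n p) random_orientation"

definition out_cluster :: "('v \<times> 'v) set \<Rightarrow> 'v \<Rightarrow> 'v set" where
  "out_cluster G v = {u. (v, u) \<in> G\<^sup>*}"

definition in_cluster :: "('v \<times> 'v) set \<Rightarrow> 'v \<Rightarrow> 'v set" where
  "in_cluster G v = {u. (u, v) \<in> G\<^sup>*}"

definition out_prob :: "real \<Rightarrow> nat \<Rightarrow> nat \<Rightarrow> nat set \<Rightarrow> real" where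
  "out_prob p n s S = measure_pmf.prob (random_digraph n p) {G. out_cluster G s = S}"

definition out_in_prob ::
    "real \<Rightarrow> nat \<Rightarrow> nat \<Rightarrow> nat set \<Rightarrow> nat \<Rightarrow> nat set \<Rightarrow> real" where
  "out_in_prob p n t T a A =
     measure_pmf.prob (random_digraph n p) {G. out_cluster G t = T \<and> in_cluster G a = A}"

definition out_config :: "nat \<Rightarrow> nat \<Rightarrow> nat \<Rightarrow> nat set \<Rightarrow> bool" where
  "out_config n k s S \<longleftrightarrow> s \<in> S \<and> S \<subseteq> {1..n} \<and> card S = k"

text \<open>
  A vertex of \<open>A \<inter> T\<close> is reachable from \<open>t\<close> and reaches \<open>a\<close>, so if \<open>A \<inter> T\<close> is nonempty it
  contains both \<open>a\<close> and \<open>t\<close>. Sets violating this give an event of probability 0, and they can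
  have the same sizes as sets giving positive probability; the last conjunct excludes them, since
  otherwise the probability would not be a function of the sizes.
\<close>

definition out_in_config ::
    "nat \<Rightarrow> nat \<Rightarrow> nat \<Rightarrow> nat \<Rightarrow> nat \<Rightarrow> nat set \<Rightarrow> nat \<Rightarrow> nat set \<Rightarrow> bool" where
  "out_in_config n \<tau> \<alpha> r t T a A \<longleftrightarrow>
     a \<noteq> t \<and> t \<in> T \<and> T \<subseteq> {1..n} \<and> a \<in> A \<and> A \<subseteq> {1..n} \<and>
     card T = \<tau> \<and> card A = \<alpha> \<and> card ({1..n} - (A \<union> T)) = r \<and>
     (A \<inter> T \<noteq> {} \<longrightarrow> a \<in> A \<inter> T \<and> t \<in> A \<inter> T)"

text \<open>
  The descriptions in \<open>d_p\<close> and \<open>N_p\<close> are meaningful because the probability is the same for all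
  sets of the given sizes. \<open>N_p\<close> is 0 when there is no admissible choice of sets. In the range
  $\tau, \alpha \ge 1$, $\tau + \alpha \ge n - r \ge \tau, \alpha$ (with $n \ge 2$) this happens
  exactly when $|A \cap T| = \tau + \alpha - (n - r)$ would be 1.
\<close>

definition d_p :: "real \<Rightarrow> nat \<Rightarrow> nat \<Rightarrow> real" where
  "d_p p n k = (THE c. \<exists>s S. out_config n k s S \<and> c = out_prob p n s S)"

definition N_p :: "real \<Rightarrow> nat \<Rightarrow> nat \<Rightarrow> nat \<Rightarrow> nat \<Rightarrow> real" where
  "N_p p n \<tau> \<alpha> r =
     (if \<exists>t T a A. out_in_config n \<tau> \<alpha> r t T a A
      then THE c. \<exists>t T a A. out_in_config n \<tau> \<alpha> r t T a A \<and> c = out_in_prob p n t T a A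
      else 0)"

end

theory Submission
  imports Defs
begin

text \<open>
  An oriented graph with $m$ arcs on $n$ vertices has probability $x^m q^{\binom n2 - m}$. This weight is
  invariant under relabelling and under reversal of all arcs, which makes $d_p$ and $N_p$ well defined and
  gives the symmetry (ii), and it factorizes over disjoint sets of vertex pairs.

  For (i), no arc may lead from $T$ to a vertex outside $A \cup T$, nor from such a vertex to $A$;
  apart from that the graph on $A \cup T$ is unconstrained by the remaining vertices.

  For (iii) and (iv), fix a vertex $v \ne a$ of $A \setminus T$ and let $Z$ be the set of vertices of $A$ that
  reach $a$ only through $v$. Then $Z$ is the in-cluster of $v$ within $Z$, there are no arcs from $T$
  to $Z$ or from $Z \setminus \{v\}$ to $A \setminus Z$, at least one arc from $v$ to $A \setminus Z$, and the graph
  on the vertices outside $Z$ realizes the pair $(T, A \setminus Z)$. Summing over $Z$ gives the recursion.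
  Finally, (v) says that the probabilities of all pairs $(T, A)$ add up to 1.
\<close>

section \<open>Random orientations of a set of arcs\<close>

text \<open>The pmf lives on graphs over \<open>{1..n}\<close>, whereas the recursion needs the
  graphs on \<open>Z\<close> and on \<open>V - Z\<close>. Hence \<open>oprob\<close> is a finite
  weighted sum over the oriented subgraphs of an arbitrary finite symmetric loop-free arc set.
  Independence is then a reindexing of sums, and no conditional probabilities occur, so nothing
  degenerates at p = 0 or p = 1.

  All exponents come from events of the form "G avoids a set F of arcs". A vertex pair with both
  arcs in F must stay empty, with probability q = 1 - p; a pair with one arc in F is empty or
  carries the other arc, with probability (1 - p) + p/2 = y. A doubly forbidden pair always involves
  a vertex of \<open>A \<inter> T\<close>, which is why j appears in the explicit exponents of q.

  In the recursion Z is computed from G by deleting v. The events for different Z are therefore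
  disjoint and exhaustive, and no inclusion-exclusion over cut sets is needed.\<close>

definition arcs_on :: "'v set \<Rightarrow> ('v \<times> 'v) set" where
  "arcs_on V = V \<times> V - Id"

definition arc_set :: "('v \<times> 'v) set \<Rightarrow> bool" where
  "arc_set E \<longleftrightarrow> finite E \<and> sym E \<and> irrefl E"

definition orientations :: "('v \<times> 'v) set \<Rightarrow> ('v \<times> 'v) set set" where
  "orientations E = {G. G \<subseteq> E \<and> G \<inter> G\<inverse> = {}}"

text \<open>The number of vertex pairs is \<open>card E div 2\<close>, as \<open>E\<close> contains both orientations of each pair.\<close>

definition oweight :: "real \<Rightarrow> ('v \<times> 'v) set \<Rightarrow> ('v \<times> 'v) set \<Rightarrow> real" where
  "oweight p E G = (p / 2) ^ card G * (1 - p) ^ (card E div 2 - card G)"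

definition oprob :: "real \<Rightarrow> ('v \<times> 'v) set \<Rightarrow> (('v \<times> 'v) set \<Rightarrow> bool) \<Rightarrow> real" where
  "oprob p E P = (\<Sum>G | G \<in> orientations E \<and> P G. oweight p E G)"

lemma arc_set_arcs_on: "finite V \<Longrightarrow> arc_set (arcs_on V)"
  by (auto simp: arc_set_def arcs_on_def sym_def irrefl_def)

lemma finite_orientations: "finite E \<Longrightarrow> finite (orientations E)"
  unfolding orientations_def by (rule finite_subset[of _ "Pow E"]) auto

text \<open>The linear order serves to select one arc from each vertex pair, so that products and
  inductions can run over pairs.\<close>

lemma arc_set_halves:
  fixes E :: "('v::linorder \<times> 'v) set"
  assumes "arc_set E"
  obtains H where "finite H" "H \<inter> H\<inverse> = {}" "E = H \<union> H\<inverse>"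
proof
  let ?H = "{(u, v) \<in> E. u < v}"
  show "finite ?H"
    using assms by (auto simp: arc_set_def intro: finite_subset[of _ E])
  show "?H \<inter> ?H\<inverse> = {}" by auto
  show "E = ?H \<union> ?H\<inverse>"
    using assms by (auto simp: arc_set_def sym_def irrefl_def) (metis neqE)
qed

lemma card_Un_converse:
  assumes "finite H" "H \<inter> H\<inverse> = {}"
  shows "card (H \<union> H\<inverse>) = 2 * card H"
  using assms by (simp add: card_Un_disjoint card_inverse)

lemma even_card_arc_set:
  fixes E :: "('v::linorder \<times> 'v) set"
  shows "arc_set E \<Longrightarrow> even (card E)"
  by (metis arc_set_halves card_Un_converse dvd_triv_left)

lemma card_orientation_le:
  assumes "arc_set E" "G \<in> orientations E"
  shows "card G \<le> card E div 2"
proof -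
  have "finite G" "G \<union> G\<inverse> \<subseteq> E"
    using assms by (auto simp: arc_set_def orientations_def sym_def intro: finite_subset)
  then have "2 * card G \<le> card E"
    using assms card_Un_converse[of G] card_mono[of E "G \<union> G\<inverse>"]
    by (auto simp: arc_set_def orientations_def)
  then show ?thesis by linarith
qed

lemma oprob_cong:
  assumes "\<And>G. G \<in> orientations E \<Longrightarrow> P G = Q G"
  shows "oprob p E P = oprob p E Q"
  unfolding oprob_def using assms by (intro sum.cong) auto

text \<open>Independence of disjoint sets of pairs: an oriented graph on the union is uniquely a
  pair of oriented graphs, and both exponents of the weight add. Evenness of \<open>card E1\<close>
  and \<open>card E2\<close> makes the halving additive, and \<open>card_orientation_le\<close>
  keeps the subtractions in the exponents from truncating.\<close>

lemma oprob_prod: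
  fixes E1 E2 :: "('v::linorder \<times> 'v) set"
  assumes "arc_set E1" "arc_set E2" "E1 \<inter> E2 = {}"
  shows "oprob p (E1 \<union> E2) (\<lambda>G. P (G \<inter> E1) \<and> Q (G \<inter> E2)) = oprob p E1 P * oprob p E2 Q"
proof -
  have fin: "finite E1" "finite E2" using assms by (auto simp: arc_set_def)
  have cardE: "card (E1 \<union> E2) div 2 = card E1 div 2 + card E2 div 2"
    using even_card_arc_set[OF assms(1)] even_card_arc_set[OF assms(2)] assms(3) fin
    by (simp add: card_Un_disjoint div_plus_div_distrib_dvd_left)
  have split: "oweight p (E1 \<union> E2) (G1 \<union> G2) = oweight p E1 G1 * oweight p E2 G2"
    if "G1 \<in> orientations E1" "G2 \<in> orientations E2" for G1 G2
  proof -
    have "finite G1" "finite G2" "G1 \<inter> G2 = {}"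
      using that assms(3) fin by (auto simp: orientations_def intro: finite_subset)
    then have "card (G1 \<union> G2) = card G1 + card G2" by (rule card_Un_disjoint)
    moreover have "card G1 \<le> card E1 div 2" "card G2 \<le> card E2 div 2"
      using that assms card_orientation_le by blast+
    ultimately show ?thesis
      unfolding oweight_def cardE by (simp add: power_add flip: diff_diff_left add_diff_assoc add_diff_assoc2)
  qed
  have inv: "E1\<inverse> = E1" "E2\<inverse> = E2"
    using assms by (simp_all add: arc_set_def sym_conv_converse_eq)
  have "oprob p E1 P * oprob p E2 Q =
    (\<Sum>(G1, G2) \<in> {G. G \<in> orientations E1 \<and> P G} \<times> {G. G \<in> orientations E2 \<and> Q G}.
       oweight p E1 G1 * oweight p E2 G2)"
    unfolding oprob_def by (simp add: sum_product sum.cartesian_product)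
  also have "\<dots> = oprob p (E1 \<union> E2) (\<lambda>G. P (G \<inter> E1) \<and> Q (G \<inter> E2))"
    unfolding oprob_def
  proof (rule sum.reindex_bij_witness[where i = "\<lambda>G. (G \<inter> E1, G \<inter> E2)" and j = "\<lambda>(G1, G2). G1 \<union> G2"],
      goal_cases)
    case (1 G) then show ?case using assms(3) by (auto simp: orientations_def)
  next
    case (2 G)
    then obtain G1 G2 where G: "G = (G1, G2)" "G1 \<in> orientations E1" "P G1" "G2 \<in> orientations E2" "Q G2"
      by auto
    have r: "(G1 \<union> G2) \<inter> E1 = G1" "(G1 \<union> G2) \<inter> E2 = G2"
      using G assms(3) by (auto simp: orientations_def)
    have "G1\<inverse> \<subseteq> E1" "G2\<inverse> \<subseteq> E2" using G inv by (auto simp: orientations_def)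
    then have "G1 \<union> G2 \<in> orientations (E1 \<union> E2)"
      using G assms(3) unfolding orientations_def by (auto simp: converse_Un)
    then show ?case using r G by auto
  next
    case (3 G) then show ?case by (auto simp: orientations_def)
  next
    case (4 G) then show ?case by (auto simp: orientations_def)
  next
    case (5 G) then show ?case using split by auto
  qed
  finally show ?thesis by simp
qed

lemma oprob_False: "oprob p E (\<lambda>G. False) = 0"
  by (simp add: oprob_def)

lemma oprob_empty_graph:
  assumes "finite E"
  shows "oprob p E (\<lambda>G. G = {}) = (1 - p) ^ (card E div 2)"
proof -
  have "{G. G \<in> orientations E \<and> G = {}} = {{}}" by (auto simp: orientations_def)
  then show ?thesis by (simp add: oprob_def oweight_def)
qed

lemma oprob_avoid_half:
  assumes "finite H" "H \<inter> H\<inverse> = {}"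
  shows "oprob p (H \<union> H\<inverse>) (\<lambda>G. G \<inter> H = {}) = (1 - p / 2) ^ card H"
proof -
  have eq: "{G. G \<in> orientations (H \<union> H\<inverse>) \<and> G \<inter> H = {}} = Pow (H\<inverse>)"
    using assms(2) by (auto simp: orientations_def)
  have "oprob p (H \<union> H\<inverse>) (\<lambda>G. G \<inter> H = {}) =
      (\<Sum>G\<in>Pow (H\<inverse>). (\<Prod>e\<in>G. p / 2) * (\<Prod>e\<in>H\<inverse> - G. 1 - p))"
    unfolding oprob_def eq oweight_def card_Un_converse[OF assms]
    using assms by (intro sum.cong) (auto simp: card_Diff_subset finite_subset card_inverse)
  \<comment> \<open>Expanding the product over pairs: each pair contributes p/2 if its permitted arc
    is present and 1 - p if it is empty.\<close>
  also have "\<dots> = (\<Prod>e\<in>H\<inverse>. p / 2 + (1 - p))"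
    using assms(1) by (intro prod_add[symmetric]) auto
  also have "\<dots> = (1 - p / 2) ^ card H" by (simp add: card_inverse field_simps)
  finally show ?thesis .
qed

text \<open>A single pair has three states of weights p/2, p/2 and 1 - p, which add up to 1;
  \<open>oprob_prod\<close> adds one pair at a time.\<close>

lemma oprob_True:
  fixes E :: "('v::linorder \<times> 'v) set"
  assumes "arc_set E"
  shows "oprob p E (\<lambda>G. True) = 1"
proof -
  obtain H where H: "finite H" "H \<inter> H\<inverse> = {}" "E = H \<union> H\<inverse>"
    using assms by (rule arc_set_halves)
  have "oprob p (H \<union> H\<inverse>) (\<lambda>G. True) = 1" using H(1,2)
  proof (induction H)
    case empty
    have "{G. G \<in> orientations ({} :: ('v \<times> 'v) set)} = {{}}" by (auto simp: orientations_def)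
    then show ?case by (simp add: oprob_def oweight_def)
  next
    case (insert e H)
    obtain u v where e: "e = (u, v)" by force
    have uv: "u \<noteq> v" using insert e by auto
    let ?E = "{(u, v), (v, u)}"
    have os: "orientations ?E = {{}, {(u, v)}, {(v, u)}}"
      using uv by (auto simp: orientations_def)
    have "card ?E = 2" using uv by simp
    moreover have "oprob p ?E (\<lambda>G. True) = (\<Sum>G\<in>orientations ?E. oweight p ?E G)"
      by (simp add: oprob_def)
    ultimately have pair: "oprob p ?E (\<lambda>G. True) = 1"
      using uv unfolding os oweight_def by simp
    have "oprob p (?E \<union> (H \<union> H\<inverse>)) (\<lambda>G. True \<and> True) =
        oprob p ?E (\<lambda>G. True) * oprob p (H \<union> H\<inverse>) (\<lambda>G. True)"
      using insert uv e
      by (intro oprob_prod) (auto simp: arc_set_def sym_def irrefl_def)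
    moreover have "?E \<union> (H \<union> H\<inverse>) = insert e H \<union> (insert e H)\<inverse>" using e by auto
    moreover have "oprob p (H \<union> H\<inverse>) (\<lambda>G. True) = 1" using insert by auto
    ultimately show ?case using pair by simp
  qed
  then show ?thesis using H by simp
qed

text \<open>The pairs split into three independent groups: \<open>E1\<close> with both arcs
  forbidden, \<open>E2\<close> with exactly one forbidden, and the unconstrained rest
  \<open>E3\<close>. They contribute powers of q, powers of y and the factor 1.\<close>

lemma oprob_avoid:
  fixes E F :: "('v::linorder \<times> 'v) set"
  assumes "arc_set E" "F \<subseteq> E"
  shows "oprob p E (\<lambda>G. G \<inter> F = {}) =
    (1 - p) ^ (card (F \<inter> F\<inverse>) div 2) * (1 - p / 2) ^ card (F - F\<inverse>)"
proof -
  define H where "H = F - F\<inverse>"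
  define E1 where "E1 = F \<inter> F\<inverse>"
  define E2 where "E2 = H \<union> H\<inverse>"
  define E3 where "E3 = E - (E1 \<union> E2)"
  have fin: "finite E" "finite F" using assms by (auto simp: arc_set_def finite_subset)
  have inv: "E\<inverse> = E" "F\<inverse> \<subseteq> E"
    using assms by (auto simp: arc_set_def sym_def)
  have sub: "E1 \<subseteq> E" "E2 \<subseteq> E" "H \<inter> H\<inverse> = {}" "finite H" "E1 \<inter> E2 = {}"
    using assms inv fin by (auto simp: E1_def E2_def H_def)
  have "sym E1" "sym E2" "sym E3"
    using inv by (auto simp: sym_conv_converse_eq E1_def E2_def E3_def)
  then have arc: "arc_set E1" "arc_set E2" "arc_set E3" "arc_set (E2 \<union> E3)"
    using sub assms fin finite_subset by (auto simp: arc_set_def irrefl_def E3_def intro: sym_Un)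
  have "oprob p E (\<lambda>G. G \<inter> F = {}) =
      oprob p (E1 \<union> (E2 \<union> E3)) (\<lambda>G. G \<inter> E1 = {} \<and> (\<lambda>G. G \<inter> E2 \<inter> H = {} \<and> True) (G \<inter> (E2 \<union> E3)))"
  proof -
    have "E1 \<union> (E2 \<union> E3) = E" using sub by (auto simp: E3_def)
    moreover have "F = E1 \<union> H" "H \<subseteq> E2" by (auto simp: E1_def H_def E2_def)
    ultimately show ?thesis by (intro arg_cong2[where f = "oprob p"] ext) auto
  qed
  also have "\<dots> = oprob p E1 (\<lambda>G. G = {}) * oprob p (E2 \<union> E3) (\<lambda>G. G \<inter> E2 \<inter> H = {} \<and> True)"
    using arc sub by (intro oprob_prod[where P = "\<lambda>G. G = {}"]) (auto simp: E3_def)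
  also have "oprob p (E2 \<union> E3) (\<lambda>G. G \<inter> E2 \<inter> H = {} \<and> True) =
      oprob p E2 (\<lambda>G. G \<inter> H = {}) * oprob p E3 (\<lambda>G. True)"
    using arc sub by (intro oprob_prod[where P = "\<lambda>G. G \<inter> H = {}" and Q = "\<lambda>G. True"]) (auto simp: E3_def)
  also have "\<dots> = (1 - p / 2) ^ card H"
    using arc sub by (simp add: oprob_True oprob_avoid_half E2_def)
  also have "oprob p E1 (\<lambda>G. G = {}) = (1 - p) ^ (card E1 div 2)"
    using arc by (intro oprob_empty_graph) (auto simp: arc_set_def)
  finally show ?thesis by (simp add: E1_def H_def)
qed

lemma oprob_partition:
  assumes "finite E" "finite I" "\<And>G. G \<in> orientations E \<Longrightarrow> P G \<Longrightarrow> h G \<in> I"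
  shows "oprob p E P = (\<Sum>i\<in>I. oprob p E (\<lambda>G. P G \<and> h G = i))"
proof -
  have "oprob p E P = (\<Sum>i\<in>I. sum (oweight p E) {G \<in> {G. G \<in> orientations E \<and> P G}. h G = i})"
    unfolding oprob_def
    using assms finite_orientations[OF assms(1)] by (intro sum.group[symmetric]) auto
  then show ?thesis by (simp add: oprob_def conj_assoc)
qed

lemma oprob_diff:
  assumes "finite E"
  shows "oprob p E (\<lambda>G. P G \<and> \<not> Q G) = oprob p E P - oprob p E (\<lambda>G. P G \<and> Q G)"
  using oprob_partition[OF assms, of UNIV P Q p] by (simp add: UNIV_bool)

section \<open>Invariance of the weight under reversal and relabelling\<close>

lemma oprob_converse:
  assumes "arc_set E"
  shows "oprob p E P = oprob p E (\<lambda>G. P (G\<inverse>))"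
proof -
  have "E\<inverse> = E" using assms by (simp add: arc_set_def sym_conv_converse_eq)
  then have "G\<inverse> \<in> orientations E" if "G \<in> orientations E" for G
    using that by (auto simp: orientations_def)
  then show ?thesis
    unfolding oprob_def
    by (intro sum.reindex_bij_witness[where i = converse and j = converse])
      (auto simp: oweight_def card_inverse)
qed

lemma arcs_on_image:
  assumes "inj_on f V"
  shows "map_prod f f ` arcs_on V = arcs_on (f ` V)"
  using assms by (auto simp: arcs_on_def image_iff dest: inj_onD)

lemma orientations_image:
  assumes inj: "inj_on f V" and im: "f ` V = W" and G: "G \<in> orientations (arcs_on V)"
  shows "map_prod f f ` G \<in> orientations (arcs_on W)"
proof -
  have "(map_prod f f ` G) \<inter> (map_prod f f ` G)\<inverse> = {}"
  proof (rule ccontr)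
    assume "(map_prod f f ` G) \<inter> (map_prod f f ` G)\<inverse> \<noteq> {}"
    then obtain a b c d where *: "(a, b) \<in> G" "(c, d) \<in> G" "f a = f d" "f b = f c" by auto
    moreover have "a \<in> V" "b \<in> V" "c \<in> V" "d \<in> V"
      using * G by (auto simp: orientations_def arcs_on_def)
    ultimately have "a = d" "b = c" using inj by (auto dest: inj_onD)
    then show False using * G by (auto simp: orientations_def)
  qed
  moreover have "map_prod f f ` G \<subseteq> arcs_on W"
    using G arcs_on_image[OF inj] im by (auto simp: orientations_def)
  ultimately show ?thesis by (simp add: orientations_def)
qed

lemma oprob_relabel:
  assumes f: "bij_betw f V W" and fin: "finite V"
  shows "oprob p (arcs_on W) P = oprob p (arcs_on V) (\<lambda>G. P (map_prod f f ` G))"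
proof -
  define g where "g = inv_into V f"
  have gf: "\<And>x. x \<in> V \<Longrightarrow> g (f x) = x" and fg: "\<And>x. x \<in> W \<Longrightarrow> f (g x) = x"
    using f unfolding g_def by (auto simp: bij_betw_inv_into_left bij_betw_inv_into_right)
  have inv: "map_prod g g ` map_prod f f ` G = G" if "G \<subseteq> arcs_on V" for G
    using that gf by (force simp: arcs_on_def image_iff)
  have inv': "map_prod f f ` map_prod g g ` G = G" if "G \<subseteq> arcs_on W" for G
    using that fg by (force simp: arcs_on_def image_iff)
  have "inj_on f V" "f ` V = W" using f by (auto simp: bij_betw_def)
  moreover have "inj_on g W" "g ` W = V"
    using bij_betw_inv_into[OF f] by (auto simp: g_def bij_betw_def)
  ultimately have ori: "G \<in> orientations (arcs_on V) \<Longrightarrow> map_prod f f ` G \<in> orientations (arcs_on W)"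
    and ori': "H \<in> orientations (arcs_on W) \<Longrightarrow> map_prod g g ` H \<in> orientations (arcs_on V)" for G H
    by (simp_all only: orientations_image)
  have cardf: "card (map_prod f f ` G) = card G" if "G \<subseteq> arcs_on V" for G
    by (intro card_image inj_on_inverseI[where g = "map_prod g g"])
      (use that gf in \<open>auto simp: arcs_on_def\<close>)
  have "map_prod f f ` arcs_on V = arcs_on W" using arcs_on_image[of f V] f by (simp add: bij_betw_def)
  then have cards: "card (arcs_on W) = card (arcs_on V)" using cardf[of "arcs_on V"] by simp
  show ?thesis
    unfolding oprob_def
    by (rule sum.reindex_bij_witness[where j = "\<lambda>G. map_prod g g ` G" and i = "\<lambda>G. map_prod f f ` G"])
      (use ori ori' inv inv' cardf cards in \<open>auto simp: oweight_def orientations_def\<close>,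
       metis ori' inv' cardf)
qed

section \<open>The random digraph\<close>

lemma finite_all_edges [simp]: "finite (all_edges n)"
  by (rule finite_subset[of _ "{1..n} \<times> {1..n}"]) (auto simp: all_edges_def)

lemma arcs_on_eq_all_edges: "arcs_on {1..n} = all_edges n \<union> (all_edges n)\<inverse>"
  by (auto simp: arcs_on_def all_edges_def)

lemma all_edges_asym: "all_edges n \<inter> (all_edges n)\<inverse> = {}"
  by (auto simp: all_edges_def)

lemma card_arcs_on_div2: "card (arcs_on {1..n}) div 2 = card (all_edges n)"
  using card_Un_converse[OF finite_all_edges all_edges_asym] unfolding arcs_on_eq_all_edges by simp

lemma pmf_random_graph:
  assumes "0 \<le> p" "p \<le> 1" "E \<subseteq> all_edges n"
  shows "pmf (random_graph n p) E = p ^ card E * (1 - p) ^ (card (all_edges n) - card E)"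
proof -
  let ?M = "Pi_pmf (all_edges n) False (\<lambda>_. bernoulli_pmf p)"
  \<comment> \<open>Many \<open>f\<close> select the same edge set, as values outside
    \<open>all_edges n\<close> are ignored. All of them except the indicator of \<open>E\<close> are
    \<open>True\<close> somewhere outside, which has mass 0 because the default value is
    \<open>False\<close>.\<close>
  have "pmf (random_graph n p) E = measure ?M {\<lambda>e. e \<in> E}"
    unfolding random_graph_def pmf_map
    by (rule measure_prob_cong_0) (use assms(3) in \<open>auto simp: pmf_Pi fun_eq_iff\<close>)
  also have "\<dots> = (\<Prod>e\<in>all_edges n. pmf (bernoulli_pmf p) (e \<in> E))"
    using assms(3) by (subst measure_measure_pmf_finite) (auto intro!: pmf_Pi')
  also have "\<dots> = (\<Prod>e\<in>E. p) * (\<Prod>e\<in>all_edges n - E. 1 - p)"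
    using assms by (subst prod.subset_diff[OF assms(3)]) simp_all
  also have "\<dots> = p ^ card E * (1 - p) ^ (card (all_edges n) - card E)"
    using assms(3) by (simp add: card_Diff_subset finite_subset)
  finally show ?thesis .
qed

text \<open>Inverts the orientation step: an oriented graph determines its underlying edge set, so
  only one term of the mixture over undirected graphs can produce it.\<close>

definition edges_of :: "(nat \<times> nat) set \<Rightarrow> (nat \<times> nat) set" where
  "edges_of G = {(u, v). u < v \<and> ((u, v) \<in> G \<or> (v, u) \<in> G)}"

lemma orient_arcs:
  assumes "E \<subseteq> all_edges n"
  shows "(\<lambda>(u, v). if f (u, v) then (u, v) else (v, u)) ` E \<in> orientations (arcs_on {1..n})"
    and "edges_of ((\<lambda>(u, v). if f (u, v) then (u, v) else (v, u)) ` E) = E"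
proof -
  let ?h = "\<lambda>(u, v). if f (u, v) then (u, v) else (v, u)"
  have lt: "u < v" if "(u, v) \<in> E" for u v
    using subsetD[OF assms that] by (simp add: all_edges_def)
  then have "(v, u) \<notin> E" if "(u, v) \<in> E" for u v using that by (meson less_asym)
  then show "?h ` E \<in> orientations (arcs_on {1..n})"
    unfolding orientations_def arcs_on_eq_all_edges using assms by (auto split: if_splits)
  show "edges_of (?h ` E) = E"
  proof (rule set_eqI)
    fix e :: "nat \<times> nat"
    obtain u v where e: "e = (u, v)" by force
    have "e \<in> edges_of (?h ` E)" if "e \<in> E"
    proof -
      have "?h e \<in> ?h ` E" using that by (rule imageI)
      then show ?thesis using lt that e by (auto simp: edges_of_def split: if_splits)
    qed
    moreover have "e \<in> E" if *: "e \<in> edges_of (?h ` E)"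
    proof -
      have uv: "u < v" "(u, v) \<in> ?h ` E \<or> (v, u) \<in> ?h ` E"
        using * unfolding e edges_of_def by simp_all
      then obtain x where "x \<in> E" "?h x = (u, v) \<or> ?h x = (v, u)" by (metis (no_types, lifting) imageE)
      moreover obtain a b where "x = (a, b)" by force
      ultimately have ab: "(a, b) \<in> E" "?h (a, b) = (u, v) \<or> ?h (a, b) = (v, u)" by blast+
      then show ?thesis using lt[of a b] e uv(1) by (auto split: if_splits)
    qed
    ultimately show "e \<in> edges_of (?h ` E) \<longleftrightarrow> e \<in> E" by blast
  qed
qed

lemma pmf_random_orientation:
  assumes "E \<subseteq> all_edges n" and G: "G \<in> orientations (arcs_on {1..n})"
  shows "pmf (random_orientation E) G = (if E = edges_of G then (1 / 2) ^ card E else 0)"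
proof -
  let ?M = "Pi_pmf E False (\<lambda>_. bernoulli_pmf (1 / 2))"
  let ?h = "\<lambda>f :: nat \<times> nat \<Rightarrow> bool. (\<lambda>(u, v). if f (u, v) then (u, v) else (v, u)) ` E"
  have fin: "finite E" using assms(1) by (rule finite_subset) simp
  show ?thesis
  proof (cases "E = edges_of G")
    case False
    then have "G \<notin> ?h ` set_pmf ?M" using orient_arcs(2)[OF assms(1)] by blast
    then show ?thesis using False unfolding random_orientation_def by (simp add: pmf_map_outside)
  next
    case True
    \<comment> \<open>The only coin outcome of positive mass that yields \<open>G\<close>: an edge
      keeps its increasing direction exactly if that arc is in \<open>G\<close>, and outside
      \<open>E\<close> the default \<open>False\<close> is taken.\<close>
    let ?f0 = "\<lambda>e. e \<in> E \<and> e \<in> G"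
    have h0: "?h ?f0 = G"
    proof (intro equalityI subsetI)
      fix e assume "e \<in> ?h ?f0"
      then obtain u v where uv: "(u, v) \<in> E" "e = (if (u, v) \<in> G then (u, v) else (v, u))"
        by auto
      then have "(u, v) \<in> G \<or> (v, u) \<in> G" unfolding True by (simp add: edges_of_def)
      then show "e \<in> G" using uv(2) by (simp split: if_splits)
    next
      fix e assume e: "e \<in> G"
      obtain u v where uv: "e = (u, v)" by force
      then consider "u < v" | "v < u"
        using e G by (force simp: orientations_def arcs_on_def)
      then show "e \<in> ?h ?f0"
      proof cases
        case 1
        then have "(u, v) \<in> E" using e uv unfolding True by (simp add: edges_of_def)
        then show ?thesis using e uv by (intro image_eqI[where x = "(u, v)"]) auto
      next
        case 2
        then have "(v, u) \<in> E" using e uv unfolding True by (simp add: edges_of_def)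
        moreover have "(v, u) \<notin> G" using e uv G by (auto simp: orientations_def)
        ultimately show ?thesis using uv by (intro image_eqI[where x = "(v, u)"]) auto
      qed
    qed
    have uniq: "f = ?f0" if f: "?h f = G" "\<forall>e. e \<notin> E \<longrightarrow> \<not> f e" for f
    proof
      fix e :: "nat \<times> nat"
      obtain u v where uv: "e = (u, v)" by force
      show "f e = ?f0 e"
      proof (cases "e \<in> E")
        case True
        have "(if f e then (u, v) else (v, u)) \<in> ?h f" using True uv by (intro image_eqI[where x = "(u, v)"]) auto
        moreover have "\<not> ((u, v) \<in> G \<and> (v, u) \<in> G)" using G by (auto simp: orientations_def)
        ultimately show ?thesis using f uv True by (auto split: if_splits)
      next
        case False
        then show ?thesis using f(2) by blast
      qed
    qed
    have "pmf (random_orientation E) G = measure ?M {?f0}"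
      unfolding random_orientation_def pmf_map
    proof (rule measure_prob_cong_0)
      fix f assume f: "f \<in> ?h -` {G} - {?f0}"
      then have "\<exists>e. e \<notin> E \<and> f e \<noteq> False" using uniq[of f] by auto
      then show "pmf ?M f = 0" by (rule pmf_Pi_outside[OF fin])
    next
      fix f assume "f \<in> {?f0} - ?h -` {G}"
      then show "pmf ?M f = 0" using h0 by auto
    qed
    also have "\<dots> = pmf ?M ?f0" by (rule measure_pmf_single)
    also have "\<dots> = (\<Prod>e\<in>E. pmf (bernoulli_pmf (1 / 2)) (?f0 e))"
      by (rule pmf_Pi'[OF fin]) simp
    also have "\<dots> = (\<Prod>e\<in>E. 1 / 2)"
    proof (rule prod.cong)
      fix e show "pmf (bernoulli_pmf (1 / 2)) (?f0 e) = 1 / 2" by (cases "?f0 e") simp_all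
    qed simp
    finally show ?thesis using True by simp
  qed
qed

lemma card_edges_of:
  assumes "G \<in> orientations (arcs_on {1..n})"
  shows "card (edges_of G) = card G" "edges_of G \<subseteq> all_edges n"
proof -
  show "edges_of G \<subseteq> all_edges n"
    using assms by (auto simp: edges_of_def orientations_def arcs_on_def all_edges_def)
  have G: "G \<subseteq> arcs_on {1..n}" "G \<inter> G\<inverse> = {}" using assms by (auto simp: orientations_def)
  have "bij_betw (\<lambda>(u, v). if u < v then (u, v) else (v, u)) G (edges_of G)"
    unfolding bij_betw_def
  proof
    show "inj_on (\<lambda>(u, v). if u < v then (u, v) else (v, u)) G"
      using G by (auto simp: inj_on_def split: if_splits)
    show "(\<lambda>(u, v). if u < v then (u, v) else (v, u)) ` G = edges_of G"
      using G by (fastforce simp: edges_of_def arcs_on_def image_iff split: if_splits)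
  qed
  then show "card (edges_of G) = card G" by (simp add: bij_betw_same_card)
qed

lemma set_random_graph: "set_pmf (random_graph n p) \<subseteq> Pow (all_edges n)"
  by (auto simp: random_graph_def)

text \<open>Only the term \<open>E = edges_of G\<close> survives; its edge probabilities
  \<open>p ^ card G\<close> and coin probabilities \<open>(1 / 2) ^ card G\<close> merge into the
  factor \<open>(p / 2) ^ card G\<close> of \<open>oweight\<close>.\<close>

lemma pmf_random_digraph:
  assumes p: "0 \<le> p" "p \<le> 1" and G: "G \<in> orientations (arcs_on {1..n})"
  shows "pmf (random_digraph n p) G = oweight p (arcs_on {1..n}) G"
proof -
  have "pmf (random_digraph n p) G =
      (\<Sum>E\<in>Pow (all_edges n). pmf (random_orientation E) G * pmf (random_graph n p) E)"
    unfolding random_digraph_def pmf_bind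
    by (rule integral_measure_pmf_real) (use set_random_graph in auto)
  also have "\<dots> = (\<Sum>E\<in>Pow (all_edges n).
      if E = edges_of G then (1 / 2) ^ card E * pmf (random_graph n p) E else 0)"
    using G by (intro sum.cong) (auto simp: pmf_random_orientation)
  also have "\<dots> = (1 / 2) ^ card G * pmf (random_graph n p) (edges_of G)"
    using card_edges_of[OF G] by simp
  also have "\<dots> = oweight p (arcs_on {1..n}) G"
    using card_edges_of[OF G] p
    unfolding oweight_def card_arcs_on_div2 by (simp add: pmf_random_graph power_divide)
  finally show ?thesis .
qed

text \<open>The bridge between the pmf and the weighted sums: from here on
  \<open>random_digraph\<close> is accessed only through this identity.\<close>

lemma prob_random_digraph:
  assumes "0 \<le> p" "p \<le> 1"
  shows "measure_pmf.prob (random_digraph n p) {G. P G} = oprob p (arcs_on {1..n}) P"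
proof -
  have set: "G \<in> orientations (arcs_on {1..n})" if G: "G \<in> set_pmf (random_digraph n p)" for G
  proof -
    obtain E where E: "E \<in> set_pmf (random_graph n p)" "G \<in> set_pmf (random_orientation E)"
      using G unfolding random_digraph_def set_bind_pmf by auto
    obtain f where "G = (\<lambda>(u, v). if f (u, v) then (u, v) else (v, u)) ` E"
      using E(2) unfolding random_orientation_def set_map_pmf by blast
    then show ?thesis using orient_arcs(1)[of E n f] E(1) set_random_graph[of n p] by auto
  qed
  have "measure_pmf.prob (random_digraph n p) {G. P G} =
      measure_pmf.prob (random_digraph n p) {G. G \<in> orientations (arcs_on {1..n}) \<and> P G}"
    using set by (intro measure_prob_cong_0) (auto simp: pmf_eq_0_set_pmf)
  also have "\<dots> = oprob p (arcs_on {1..n}) P"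
    unfolding oprob_def using assms
    by (subst measure_measure_pmf_finite)
      (auto intro!: sum.cong finite_subset[OF _ finite_orientations] arc_set_arcs_on
        simp: pmf_random_digraph arcs_on_def)
  finally show ?thesis .
qed

section \<open>Clusters\<close>

lemma in_cluster_converse: "in_cluster G v = out_cluster (G\<inverse>) v"
  by (auto simp: in_cluster_def out_cluster_def rtrancl_converse)

lemma out_cluster_self [simp]: "v \<in> out_cluster G v"
  by (simp add: out_cluster_def)

lemma in_cluster_self [simp]: "v \<in> in_cluster G v"
  by (simp add: in_cluster_def)

lemma out_cluster_closed: "G `` out_cluster G v \<subseteq> out_cluster G v"
  by (auto simp: out_cluster_def)

lemma out_cluster_least: "v \<in> X \<Longrightarrow> G `` X \<subseteq> X \<Longrightarrow> out_cluster G v \<subseteq> X"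
  unfolding out_cluster_def using Image_closed_trancl[of G X] by blast

lemma out_cluster_mono: "G \<subseteq> H \<Longrightarrow> out_cluster G v \<subseteq> out_cluster H v"
  unfolding out_cluster_def using rtrancl_mono[of G H] by auto

text \<open>A path from \<open>v\<close> cannot leave its cluster, so it uses only arcs inside. The
  event thereby becomes two conditions on disjoint arc sets, those inside \<open>X\<close> and those
  leaving \<open>X\<close>, which is the form that independence requires.\<close>

lemma out_cluster_eq_iff:
  "out_cluster G v = X \<longleftrightarrow> G `` X \<subseteq> X \<and> out_cluster (G \<inter> X \<times> X) v = X"
proof
  assume *: "out_cluster G v = X"
  let ?Y = "out_cluster (G \<inter> X \<times> X) v"
  have "?Y \<subseteq> X" using * out_cluster_mono[of "G \<inter> X \<times> X" G v] by auto
  moreover have "w \<in> ?Y" if "u \<in> ?Y" "(u, w) \<in> G" for u w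
  proof -
    have "u \<in> X" using that \<open>?Y \<subseteq> X\<close> by auto
    then have "w \<in> X" using that out_cluster_closed[of G v] * by auto
    then show ?thesis using that \<open>u \<in> X\<close> out_cluster_closed[of "G \<inter> X \<times> X" v] by auto
  qed
  then have "G `` ?Y \<subseteq> ?Y" by auto
  then have "X \<subseteq> ?Y" using out_cluster_least[of v ?Y G] * by simp
  ultimately show "G `` X \<subseteq> X \<and> ?Y = X" using out_cluster_closed[of G v] * by auto
next
  assume *: "G `` X \<subseteq> X \<and> out_cluster (G \<inter> X \<times> X) v = X"
  then have "v \<in> X" using out_cluster_self[of v "G \<inter> X \<times> X"] by simp
  then have "out_cluster G v \<subseteq> X" using * by (intro out_cluster_least) auto
  moreover have "X \<subseteq> out_cluster G v" using * out_cluster_mono[of "G \<inter> X \<times> X" G v] by auto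
  ultimately show "out_cluster G v = X" by auto
qed

lemma in_cluster_closed: "(u, w) \<in> G \<Longrightarrow> w \<in> in_cluster G v \<Longrightarrow> u \<in> in_cluster G v"
  by (auto simp: in_cluster_def)

lemma in_cluster_least: "v \<in> X \<Longrightarrow> G\<inverse> `` X \<subseteq> X \<Longrightarrow> in_cluster G v \<subseteq> X"
  unfolding in_cluster_converse by (rule out_cluster_least)

lemma in_cluster_mono: "G \<subseteq> H \<Longrightarrow> in_cluster G v \<subseteq> in_cluster H v"
  unfolding in_cluster_converse by (intro out_cluster_mono) auto

text \<open>\<open>G\<close> and its restriction to \<open>W\<close> have the same arcs inside
  \<open>X\<close>; they differ for this event only in the arcs from \<open>X\<close> to vertices
  outside \<open>W\<close>.\<close>

lemma out_cluster_restrict_iff: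
  assumes "G \<subseteq> V \<times> V" "X \<subseteq> W"
  shows "out_cluster G v = X \<longleftrightarrow> out_cluster (G \<inter> W \<times> W) v = X \<and> G \<inter> X \<times> (V - W) = {}"
proof -
  have "G \<inter> W \<times> W \<inter> X \<times> X = G \<inter> X \<times> X" using assms by auto
  moreover have "G `` X \<subseteq> X \<longleftrightarrow> (G \<inter> W \<times> W) `` X \<subseteq> X \<and> G \<inter> X \<times> (V - W) = {}"
    using assms by fastforce
  ultimately show ?thesis
    using out_cluster_eq_iff[of G v X] out_cluster_eq_iff[of "G \<inter> W \<times> W" v X] by auto
qed

lemma in_cluster_restrict_iff:
  assumes "G \<subseteq> V \<times> V" "X \<subseteq> W"
  shows "in_cluster G v = X \<longleftrightarrow> in_cluster (G \<inter> W \<times> W) v = X \<and> G \<inter> (V - W) \<times> X = {}"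
proof -
  have *: "G\<inverse> \<subseteq> V \<times> V" "(G \<inter> W \<times> W)\<inverse> = G\<inverse> \<inter> W \<times> W" using assms by auto
  have "G \<inter> (V - W) \<times> X = {} \<longleftrightarrow> G\<inverse> \<inter> X \<times> (V - W) = {}" by auto
  then show ?thesis
    using out_cluster_restrict_iff[OF *(1) assms(2), of v] *(2) by (simp add: in_cluster_converse)
qed

text \<open>Here \<open>A - in_cluster \<dots> a\<close> is the set of vertices of \<open>A\<close> that reach \<open>a\<close> only through \<open>v\<close>.\<close>

lemma clusters_decompose_iff:
  assumes G: "G \<subseteq> V \<times> V" and V: "V = A \<union> T" and T: "t \<in> T" and A: "a \<in> A" "v \<in> A" "v \<notin> T" "v \<noteq> a"
    and Z: "v \<in> Z" "Z \<subseteq> A - T - {a}"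
  defines "B \<equiv> V - Z"
  shows "(out_cluster G t = T \<and> in_cluster G a = A) \<and>
      A - in_cluster (G \<inter> (V - {v}) \<times> (V - {v})) a = Z \<longleftrightarrow>
    (out_cluster (G \<inter> B \<times> B) t = T \<and> in_cluster (G \<inter> B \<times> B) a = A - Z) \<and>
    in_cluster (G \<inter> Z \<times> Z) v = Z \<and>
    G \<inter> (T \<times> Z \<union> (Z - {v}) \<times> (A - Z)) = {} \<and> G \<inter> {v} \<times> (A - Z) \<noteq> {}"
proof -
  let ?G' = "G \<inter> (V - {v}) \<times> (V - {v})"
  let ?I = "in_cluster ?G' a"
  have sub: "T \<subseteq> B" "A - Z \<subseteq> B" "B \<subseteq> V - {v}" "Z \<subseteq> A" "Z \<subseteq> V" "V - B = Z"
    using V Z by (auto simp: B_def)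
  have out: "out_cluster G t = T \<longleftrightarrow> out_cluster (G \<inter> B \<times> B) t = T \<and> G \<inter> T \<times> Z = {}"
    using out_cluster_restrict_iff[OF G sub(1), of t] sub by auto
  show ?thesis
  proof (intro iffI)
    assume asm: "(out_cluster G t = T \<and> in_cluster G a = A) \<and> A - ?I = Z"
    have Acl: "u \<in> A" if "(u, w) \<in> G" "w \<in> A" for u w
      using in_cluster_closed[OF that(1), of a] that(2) asm by simp
    have "?I \<subseteq> A" using asm in_cluster_mono[of ?G' G a] by auto
    then have I: "?I = A - Z" using asm by auto
    have "?G' \<inter> B \<times> B = G \<inter> B \<times> B" using sub by auto
    then have "in_cluster (G \<inter> B \<times> B) a = A - Z"
      using in_cluster_restrict_iff[of ?G' V "A - Z" B a] I G sub by auto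
    moreover have noZA: "G \<inter> (Z - {v}) \<times> (A - Z) = {}"
    proof -
      have False if "z \<in> Z - {v}" "w \<in> A - Z" "(z, w) \<in> G" for z w
      proof -
        have "(z, w) \<in> ?G'" using that sub Z G by auto
        then have "z \<in> ?I" using in_cluster_closed[of z w ?G' a] that I by simp
        then show False using I that by auto
      qed
      then show ?thesis by auto
    qed
    \<comment> \<open>Without such an arc nothing in \<open>Z\<close> points into
      \<open>A - Z\<close>. Then \<open>A - Z\<close> is closed under predecessors and contains
      \<open>a\<close>, so it would contain the whole in-cluster of \<open>a\<close>, although
      \<open>v\<close> belongs to that cluster.\<close>
    moreover have "G \<inter> {v} \<times> (A - Z) \<noteq> {}"
    proof
      assume no: "G \<inter> {v} \<times> (A - Z) = {}"
      have "G\<inverse> `` (A - Z) \<subseteq> A - Z"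
      proof
        fix u assume "u \<in> G\<inverse> `` (A - Z)"
        then obtain w where w: "(u, w) \<in> G" "w \<in> A - Z" by auto
        moreover have "u \<in> A" using Acl w by blast
        ultimately show "u \<in> A - Z" using no noZA by auto
      qed
      then have "in_cluster G a \<subseteq> A - Z"
        using A Z by (intro in_cluster_least) auto
      then show False using asm A Z by auto
    qed
    \<comment> \<open>Since \<open>v\<close> is the only exit from \<open>Z\<close> into
      \<open>A - Z\<close>, the set \<open>A - Z \<union> ?J\<close> is closed under predecessors.
      It therefore contains all of \<open>A\<close>, which forces
      \<open>Z \<subseteq> ?J\<close>.\<close>
    moreover have "in_cluster (G \<inter> Z \<times> Z) v = Z"
    proof
      let ?J = "in_cluster (G \<inter> Z \<times> Z) v"
      show "?J \<subseteq> Z" using Z by (intro in_cluster_least) auto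
      have "G\<inverse> `` (A - Z \<union> ?J) \<subseteq> A - Z \<union> ?J"
      proof
        fix u assume "u \<in> G\<inverse> `` (A - Z \<union> ?J)"
        then obtain w where w: "(u, w) \<in> G" "w \<in> A - Z \<union> ?J" by auto
        then have "w \<in> A" using \<open>?J \<subseteq> Z\<close> sub by auto
        then have "u \<in> A" using Acl w by blast
        show "u \<in> A - Z \<union> ?J"
        proof (cases "u \<in> Z")
          case uZ: True
          show ?thesis
          proof (cases "w \<in> ?J")
            case True
            then have "(u, w) \<in> G \<inter> Z \<times> Z" using w uZ \<open>?J \<subseteq> Z\<close> by auto
            then have "u \<in> ?J" using True by (rule in_cluster_closed)
            then show ?thesis by simp
          next
            case False
            then have "u = v" using w uZ noZA by blast
            then show ?thesis by simp
          qed
        qed (use \<open>u \<in> A\<close> in auto)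
      qed
      then have "in_cluster G a \<subseteq> A - Z \<union> ?J" using A Z by (intro in_cluster_least) auto
      then show "Z \<subseteq> ?J" using asm sub by auto
    qed
    ultimately show "(out_cluster (G \<inter> B \<times> B) t = T \<and> in_cluster (G \<inter> B \<times> B) a = A - Z) \<and>
        in_cluster (G \<inter> Z \<times> Z) v = Z \<and>
        G \<inter> (T \<times> Z \<union> (Z - {v}) \<times> (A - Z)) = {} \<and> G \<inter> {v} \<times> (A - Z) \<noteq> {}"
      using out asm by blast
  next
    assume asm: "(out_cluster (G \<inter> B \<times> B) t = T \<and> in_cluster (G \<inter> B \<times> B) a = A - Z) \<and>
      in_cluster (G \<inter> Z \<times> Z) v = Z \<and>
      G \<inter> (T \<times> Z \<union> (Z - {v}) \<times> (A - Z)) = {} \<and> G \<inter> {v} \<times> (A - Z) \<noteq> {}"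
    have outT: "out_cluster G t = T" using asm out by auto
    have pred: "u \<in> A - Z" if "(u, w) \<in> G" "w \<in> A - Z" "u \<in> B" for u w
    proof -
      have "(u, w) \<in> G \<inter> B \<times> B" using that sub by auto
      then show ?thesis using in_cluster_closed[of u w "G \<inter> B \<times> B" a] asm that by simp
    qed
    \<comment> \<open>A predecessor of \<open>A\<close> outside \<open>A\<close> would lie in
      \<open>T\<close>. It cannot point into \<open>Z\<close>, as those arcs are forbidden, nor into
      \<open>A - Z\<close>, which is already closed within \<open>B\<close>.\<close>
    have "G\<inverse> `` A \<subseteq> A"
    proof
      fix u assume "u \<in> G\<inverse> `` A"
      then obtain w where w: "(u, w) \<in> G" "w \<in> A" by auto
      then have "u \<in> V" using G by auto
      show "u \<in> A"
      proof (rule ccontr)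
        assume "u \<notin> A"
        then have "u \<in> T" "u \<in> B" using \<open>u \<in> V\<close> V sub by auto
        then have "w \<notin> Z" using asm w by blast
        then show False using pred[of u w] w \<open>u \<in> B\<close> \<open>u \<notin> A\<close> by auto
      qed
    qed
    then have le: "in_cluster G a \<subseteq> A" using A by (intro in_cluster_least) auto
    have AZ: "A - Z \<subseteq> in_cluster G a" using asm in_cluster_mono[of "G \<inter> B \<times> B" G a] by auto
    have v: "v \<in> in_cluster G a" using asm AZ in_cluster_closed[of v _ G a] by blast
    have "in_cluster (G \<inter> Z \<times> Z) v \<subseteq> in_cluster G v" by (rule in_cluster_mono) auto
    then have "Z \<subseteq> in_cluster G v" using asm by simp
    also have "in_cluster G v \<subseteq> in_cluster G a"
      using v by (auto simp: in_cluster_def)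
    finally have inA: "in_cluster G a = A" using le AZ by auto
    have "A - Z \<subseteq> ?I" using asm in_cluster_mono[of "G \<inter> B \<times> B" ?G' a] sub by auto
    \<comment> \<open>Once \<open>v\<close> is deleted, no remaining vertex of \<open>Z\<close> has
      an arc into \<open>A - Z\<close>.\<close>
    moreover have "?I \<subseteq> A - Z"
    proof (rule in_cluster_least)
      show "a \<in> A - Z" using A Z by auto
      show "?G'\<inverse> `` (A - Z) \<subseteq> A - Z"
      proof
        fix u assume "u \<in> ?G'\<inverse> `` (A - Z)"
        then obtain w where w: "(u, w) \<in> G" "w \<in> A - Z" "u \<noteq> v" "u \<in> V" by auto
        then have "u \<notin> Z" using asm by blast
        then show "u \<in> A - Z" using pred[of u w] w by (auto simp: B_def)
      qed
    qed
    ultimately have "?I = A - Z" by auto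
    then show "(out_cluster G t = T \<and> in_cluster G a = A) \<and> A - ?I = Z"
      using outT inA sub by auto
  qed
qed

text \<open>Deleting \<open>v\<close> isolates it, so \<open>v\<close> is cut off from
  \<open>a\<close>. A path from \<open>T\<close> stays in \<open>T\<close> and hence avoids
  \<open>v\<close>, so the vertices of \<open>A \<inter> T\<close> still reach \<open>a\<close>.
  This fixes the range of the sets Z to be summed over.\<close>

lemma clusters_cut_set:
  assumes G: "G \<subseteq> V \<times> V" and T: "T \<subseteq> V" and A: "v \<in> A" "v \<notin> T" "v \<noteq> a"
    and cl: "out_cluster G t = T" "in_cluster G a = A"
  shows "v \<in> A - in_cluster (G \<inter> (V - {v}) \<times> (V - {v})) a"
    and "A - in_cluster (G \<inter> (V - {v}) \<times> (V - {v})) a \<subseteq> A - T - {a}"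
proof -
  let ?G' = "G \<inter> (V - {v}) \<times> (V - {v})"
  have "in_cluster ?G' a \<subseteq> insert a (V - {v})" by (rule in_cluster_least) auto
  then show "v \<in> A - in_cluster ?G' a" using A by auto
  have "(u, a) \<in> ?G'\<^sup>*" if "(u, a) \<in> G\<^sup>*" "u \<in> T" for u
    using that
  proof (induction rule: converse_rtrancl_induct)
    case (step u w)
    then have "w \<in> T" using out_cluster_closed[of G t] cl by auto
    moreover from this have "(u, w) \<in> ?G'" using step T A by auto
    ultimately show ?case using step by (auto intro: converse_rtrancl_into_rtrancl)
  qed simp
  then have "A \<inter> T \<subseteq> in_cluster ?G' a" using cl(2) by (auto simp: in_cluster_def)
  then show "A - in_cluster ?G' a \<subseteq> A - T - {a}" by auto
qed

lemma out_cluster_image: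
  assumes "inj_on f V" "G \<subseteq> V \<times> V" "v \<in> V"
  shows "out_cluster (map_prod f f ` G) (f v) = f ` out_cluster G v"
proof -
  have "(f v, f w) \<in> (map_prod f f ` G)\<^sup>*" if "(v, w) \<in> G\<^sup>*" for w
    using that by (induction rule: rtrancl_induct) (auto intro: rtrancl_into_rtrancl)
  then have fwd: "f ` out_cluster G v \<subseteq> out_cluster (map_prod f f ` G) (f v)"
    by (auto simp: out_cluster_def)
  have sub: "out_cluster G v \<subseteq> V" using assms by (intro out_cluster_least) auto
  have "out_cluster (map_prod f f ` G) (f v) \<subseteq> f ` out_cluster G v"
  proof (rule out_cluster_least)
    show "(map_prod f f ` G) `` (f ` out_cluster G v) \<subseteq> f ` out_cluster G v"
    proof
      fix y assume "y \<in> (map_prod f f ` G) `` (f ` out_cluster G v)"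
      then obtain u u' w where *: "u \<in> out_cluster G v" "(u', w) \<in> G" "f u' = f u" "y = f w" by auto
      then have "u' = u" using assms sub by (auto dest: inj_onD)
      then show "y \<in> f ` out_cluster G v" using * out_cluster_closed[of G v] by auto
    qed
  qed simp
  then show ?thesis using fwd by blast
qed

lemma in_cluster_image:
  assumes "inj_on f V" "G \<subseteq> V \<times> V" "v \<in> V"
  shows "in_cluster (map_prod f f ` G) (f v) = f ` in_cluster G v"
proof -
  have "(map_prod f f ` G)\<inverse> = map_prod f f ` G\<inverse>" by force
  moreover have "G\<inverse> \<subseteq> V \<times> V" using assms by auto
  ultimately show ?thesis using out_cluster_image[OF assms(1) _ assms(3)] by (simp add: in_cluster_converse)
qed

section \<open>Symmetry\<close>

lemma arcs_onD: "G \<in> orientations (arcs_on V) \<Longrightarrow> G \<subseteq> V \<times> V"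
  by (auto simp: orientations_def arcs_on_def)

lemma restrict_arcs_on: "G \<in> orientations (arcs_on V) \<Longrightarrow> G \<inter> arcs_on W = G \<inter> W \<times> W"
  by (auto simp: orientations_def arcs_on_def)

definition clusters :: "'v \<Rightarrow> 'v set \<Rightarrow> 'v \<Rightarrow> 'v set \<Rightarrow> ('v \<times> 'v) set \<Rightarrow> bool" where
  "clusters t T a A G \<longleftrightarrow> out_cluster G t = T \<and> in_cluster G a = A"

text \<open>\<open>out_in_config\<close> without the sizes and over any vertex set, so that it also
  applies to the smaller graph left after a removal.\<close>

definition config :: "'v set \<Rightarrow> 'v \<Rightarrow> 'v set \<Rightarrow> 'v \<Rightarrow> 'v set \<Rightarrow> bool" where
  "config V t T a A \<longleftrightarrow> a \<noteq> t \<and> t \<in> T \<and> T \<subseteq> V \<and> a \<in> A \<and> A \<subseteq> V \<and>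
     (A \<inter> T \<noteq> {} \<longrightarrow> a \<in> T \<and> t \<in> A)"

text \<open>A common vertex u of both clusters gives a path from \<open>t\<close> through u to
  \<open>a\<close>, so \<open>t\<close> reaches \<open>a\<close> and both lie in the intersection.
  This is why j = 1 never occurs.\<close>

lemma clusters_imp_config:
  assumes "clusters t T a A G" "G \<subseteq> V \<times> V" "a \<noteq> t" "t \<in> V" "a \<in> V"
  shows "config V t T a A"
proof -
  have closed: "G `` V \<subseteq> V" "G\<inverse> `` V \<subseteq> V" using assms by auto
  have "T \<subseteq> V" "A \<subseteq> V"
    using assms out_cluster_least[OF _ closed(1)] in_cluster_least[OF _ closed(2)]
    unfolding clusters_def by blast+
  moreover have "a \<in> T \<and> t \<in> A" if "A \<inter> T \<noteq> {}"
  proof -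
    from that obtain u where "u \<in> A" "u \<in> T" by auto
    then have "(t, u) \<in> G\<^sup>*" "(u, a) \<in> G\<^sup>*"
      using assms(1) by (auto simp: clusters_def out_cluster_def in_cluster_def)
    then have "(t, a) \<in> G\<^sup>*" by (rule rtrancl_trans)
    then show ?thesis using assms(1) by (auto simp: clusters_def out_cluster_def in_cluster_def)
  qed
  moreover have "t \<in> T" "a \<in> A" using assms(1) by (auto simp: clusters_def)
  ultimately show ?thesis using assms(3) by (auto simp: config_def)
qed

lemma oprob_clusters_image:
  assumes f: "bij_betw f V W" and "finite V" "config V t T a A"
  shows "oprob p (arcs_on W) (clusters (f t) (f ` T) (f a) (f ` A)) =
    oprob p (arcs_on V) (clusters t T a A)"
  unfolding oprob_relabel[OF f \<open>finite V\<close>]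
proof (rule oprob_cong)
  fix G assume "G \<in> orientations (arcs_on V)"
  then have G: "G \<subseteq> V \<times> V" by (rule arcs_onD)
  have inj: "inj_on f V" using f by (simp add: bij_betw_def)
  have "t \<in> V" "a \<in> V" "T \<subseteq> V" "A \<subseteq> V" using assms(3) by (auto simp: config_def)
  moreover have "out_cluster G t \<subseteq> V" "in_cluster G a \<subseteq> V"
    using G calculation by (intro out_cluster_least in_cluster_least; auto)+
  ultimately show "clusters (f t) (f ` T) (f a) (f ` A) (map_prod f f ` G) = clusters t T a A G"
    using out_cluster_image[OF inj G] in_cluster_image[OF inj G] inj_on_image_eq_iff[OF inj]
    unfolding clusters_def by metis
qed

lemma oprob_out_cluster_image:
  assumes f: "bij_betw f V W" and "finite V" "s \<in> S" "S \<subseteq> V"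
  shows "oprob p (arcs_on W) (\<lambda>G. out_cluster G (f s) = f ` S) =
    oprob p (arcs_on V) (\<lambda>G. out_cluster G s = S)"
  unfolding oprob_relabel[OF f \<open>finite V\<close>]
proof (rule oprob_cong)
  fix G assume "G \<in> orientations (arcs_on V)"
  then have G: "G \<subseteq> V \<times> V" by (rule arcs_onD)
  have inj: "inj_on f V" using f by (simp add: bij_betw_def)
  have "s \<in> V" using assms by auto
  moreover have "out_cluster G s \<subseteq> V" using G calculation by (intro out_cluster_least) auto
  ultimately show "(out_cluster (map_prod f f ` G) (f s) = f ` S) = (out_cluster G s = S)"
    using out_cluster_image[OF inj G] inj_on_image_eq_iff[OF inj] assms by metis
qed

section \<open>Bijections between configurations of equal sizes\<close>

lemma bij_betw_label_preserving:
  assumes fin: "finite V" "finite W"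
    and "\<And>l. card {v \<in> V. c v = l} = card {w \<in> W. d w = l}"
  obtains f where "bij_betw f V W" "\<And>v. v \<in> V \<Longrightarrow> d (f v) = c v"
proof -
  have "\<exists>g. bij_betw g {v \<in> V. c v = l} {w \<in> W. d w = l}" for l
    using assms by (intro finite_same_card_bij) auto
  then obtain g where g: "\<And>l. bij_betw (g l) {v \<in> V. c v = l} {w \<in> W. d w = l}" by metis
  define f where "f v = g (c v) v" for v
  have f: "f v \<in> W" "d (f v) = c v" if "v \<in> V" for v
    using bij_betwE[OF g, of "c v"] that by (auto simp: f_def)
  have "inj_on f V"
  proof (rule inj_onI)
    fix u v assume uv: "u \<in> V" "v \<in> V" "f u = f v"
    then have "c u = c v" using f by metis
    then show "u = v" using uv bij_betw_imp_inj_on[OF g, of "c u"] by (auto simp: f_def inj_on_def)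
  qed
  moreover have "W \<subseteq> f ` V"
  proof
    fix w assume "w \<in> W"
    then have "w \<in> g (d w) ` {v \<in> V. c v = d w}" using bij_betw_imp_surj_on[OF g, of "d w"] by auto
    then obtain v where v: "v \<in> V" "c v = d w" "w = g (d w) v" by blast
    have "f v = w" by (simp only: f_def v(2) v(3)[symmetric])
    then show "w \<in> f ` V" using v(1) by auto
  qed
  ultimately show thesis using f by (intro that[of f]) (auto simp: bij_betw_def)
qed

lemma image_eq_if_preserved:
  assumes "bij_betw f V W" "X \<subseteq> V" "Y \<subseteq> W" "\<And>v. v \<in> V \<Longrightarrow> f v \<in> Y \<longleftrightarrow> v \<in> X"
  shows "f ` X = Y"
proof
  show "f ` X \<subseteq> Y" using assms by auto
  show "Y \<subseteq> f ` X"
  proof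
    fix y assume "y \<in> Y"
    then obtain v where "v \<in> V" "y = f v" using assms by (auto simp: bij_betw_def)
    then show "y \<in> f ` X" using assms \<open>y \<in> Y\<close> by auto
  qed
qed

text \<open>Label each vertex by whether it is \<open>t\<close>, is \<open>a\<close>, lies in
  \<open>T\<close>, lies in \<open>A\<close>. The given sizes determine the size of
  \<open>A \<inter> T\<close> by inclusion-exclusion. They also determine the positions of
  \<open>a\<close> and \<open>t\<close>: both are in the intersection if it is nonempty, and
  otherwise in \<open>A - T\<close> and \<open>T - A\<close>. So the label classes have equal sizes
  and can be matched.\<close>

lemma config_bij:
  assumes fin: "finite V" "finite W" and c: "config V t T a A" "config W t' T' a' A'"
    and cards: "card V = card W" "card T = card T'" "card A = card A'"
      "card (V - (A \<union> T)) = card (W - (A' \<union> T'))"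
  obtains f where "bij_betw f V W" "f t = t'" "f ` T = T'" "f a = a'" "f ` A = A'"
proof -
  have pieces: "card V = card (V - (A \<union> T)) + card (A \<union> T)"
    "card T + card A = card (A \<union> T) + card (A \<inter> T)"
    "card T = card (A \<inter> T) + card (T - A)" "card A = card (A \<inter> T) + card (A - T)"
    if "finite V" "config V t T a A" for V T A :: "'c set" and t a
  proof -
    have sub: "A \<union> T \<subseteq> V" "finite A" "finite T"
      using that by (auto simp: config_def intro: finite_subset)
    show "card V = card (V - (A \<union> T)) + card (A \<union> T)"
      using sub that card_mono[of V "A \<union> T"] by (simp add: card_Diff_subset)
    show "card T + card A = card (A \<union> T) + card (A \<inter> T)"
      using card_Un_Int[OF sub(2,3)] by simp
    show "card T = card (A \<inter> T) + card (T - A)" "card A = card (A \<inter> T) + card (A - T)"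
      using sub card_Int_Diff[of T A] card_Int_Diff[of A T] by (simp_all add: Int_commute)
  qed
  have c3: "card (A \<inter> T) = card (A' \<inter> T')" "card (T - A) = card (T' - A')" "card (A - T) = card (A' - T')"
    using pieces[OF fin(1) c(1)] pieces[OF fin(2) c(2)] cards by linarith+
  have fins: "finite (A \<inter> T)" "finite (A' \<inter> T')"
    using fin c by (auto simp: config_def intro: finite_subset)
  have ne: "A \<inter> T \<noteq> {} \<longleftrightarrow> A' \<inter> T' \<noteq> {}" using c3(1) fins by (metis card_eq_0_iff)
  have lab: "card {v \<in> V. (v = t, v = a, v \<in> T, v \<in> A) = l} =
      card {w \<in> W. (w = t', w = a', w \<in> T', w \<in> A') = l}" for l
  proof -
    obtain b1 b2 b3 b4 where l: "l = (b1, b2, b3, b4)" by (metis prod_cases4)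
    have mem: "a \<in> T \<longleftrightarrow> a' \<in> T'" "t \<in> A \<longleftrightarrow> t' \<in> A'" using c ne by (auto simp: config_def)
    have t1: "{v \<in> V. (v = t, v = a, v \<in> T, v \<in> A) = l} =
        (if b1 then (if \<not> b2 \<and> b3 \<and> (t \<in> A) = b4 then {t} else {})
         else if b2 then (if (a \<in> T) = b3 \<and> b4 then {a} else {})
         else if b3 then (if b4 then A \<inter> T - {t} - {a} else T - A - {t} - {a})
         else if b4 then A - T - {t} - {a} else V - (A \<union> T) - {t} - {a})"
      if "config V t T a A" for V T A :: "'c set" and t a
      using that l by (auto simp: config_def)
    have pc: "card (A \<inter> T - {t} - {a}) = card (A' \<inter> T' - {t'} - {a'})"
      "card (T - A - {t} - {a}) = card (T' - A' - {t'} - {a'})"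
      "card (A - T - {t} - {a}) = card (A' - T' - {t'} - {a'})"
      "card (V - (A \<union> T) - {t} - {a}) = card (W - (A' \<union> T') - {t'} - {a'})"
      using c c3 cards(4) mem by (simp_all add: card_Diff_singleton_if config_def)
    have "card {t} = card {t'}" "card {a} = card {a'}" by simp_all
    then show ?thesis unfolding t1[OF c(1)] t1[OF c(2)]
      by (simp only: if_distrib[of card] pc mem card.empty)
  qed
  obtain f where f: "bij_betw f V W"
    "\<And>v. v \<in> V \<Longrightarrow> (f v = t', f v = a', f v \<in> T', f v \<in> A') = (v = t, v = a, v \<in> T, v \<in> A)"
    using bij_betw_label_preserving[OF fin lab] by metis
  have "t \<in> V" "a \<in> V" using c by (auto simp: config_def)
  then have "f t = t'" "f a = a'" using f(2) by blast+
  moreover have "f ` T = T'" "f ` A = A'"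
    by (rule image_eq_if_preserved[OF f(1)]; use c f(2) in \<open>auto simp: config_def\<close>)+
  ultimately show thesis using f(1) that by blast
qed

lemma out_in_config_iff:
  "out_in_config n \<tau> \<alpha> r t T a A \<longleftrightarrow> config {1..n} t T a A \<and>
     card T = \<tau> \<and> card A = \<alpha> \<and> card ({1..n} - (A \<union> T)) = r"
  by (auto simp: out_in_config_def config_def)

lemma config_image:
  assumes "bij_betw f V W" "config V t T a A"
  shows "config W (f t) (f ` T) (f a) (f ` A)"
    "card (f ` T) = card T" "card (f ` A) = card A"
    "card (W - (f ` A \<union> f ` T)) = card (V - (A \<union> T))"
proof -
  have inj: "inj_on f V" and W: "W = f ` V" using assms by (auto simp: bij_betw_def)
  have sub: "T \<subseteq> V" "A \<subseteq> V" "t \<in> V" "a \<in> V" using assms by (auto simp: config_def)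
  have "f ` A \<inter> f ` T = f ` (A \<inter> T)" using inj_on_image_Int[OF inj] sub by metis
  moreover have "f a \<noteq> f t" using assms sub inj by (auto simp: config_def inj_on_def)
  ultimately show "config W (f t) (f ` T) (f a) (f ` A)"
    using assms(2) W by (auto simp: config_def)
  show "card (f ` T) = card T" "card (f ` A) = card A"
    using inj sub by (auto intro!: card_image intro: inj_on_subset)
  have "W - (f ` A \<union> f ` T) = f ` (V - (A \<union> T))"
    using inj_on_image_set_diff[OF inj, of V "A \<union> T"] sub W by (simp add: image_Un)
  then show "card (W - (f ` A \<union> f ` T)) = card (V - (A \<union> T))"
    using inj by (auto intro!: card_image intro: inj_on_subset)
qed

context
  fixes p :: real
  assumes p: "0 \<le> p" "p \<le> 1"
begin

lemma out_in_prob_eq_oprob: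
  "out_in_prob p n t T a A = oprob p (arcs_on {1..n}) (clusters t T a A)"
  unfolding out_in_prob_def clusters_def using p by (rule prob_random_digraph)

lemma out_prob_eq_oprob:
  "out_prob p n s S = oprob p (arcs_on {1..n}) (\<lambda>G. out_cluster G s = S)"
  unfolding out_prob_def using p by (rule prob_random_digraph)

text \<open>Two admissible choices are carried into each other by a permutation of
  \<open>{1..n}\<close>, which preserves weights; this gives the uniqueness behind the definite
  description.\<close>

lemma out_in_prob_eq_N_p:
  assumes "out_in_config n \<tau> \<alpha> r t T a A"
  shows "out_in_prob p n t T a A = N_p p n \<tau> \<alpha> r"
proof -
  have eq: "out_in_prob p n t' T' a' A' = out_in_prob p n t T a A"
    if c: "out_in_config n \<tau> \<alpha> r t' T' a' A'" for t' T' a' A'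
  proof -
    obtain f where "bij_betw f {1..n} {1..n}" "f t = t'" "f ` T = T'" "f a = a'" "f ` A = A'"
      using config_bij[of "{1..n}" "{1..n}" t T a A t' T' a' A'] c assms
      unfolding out_in_config_iff by auto
    then show ?thesis
      using oprob_clusters_image[of f "{1..n}" "{1..n}" t T a A p] assms
      by (simp add: out_in_prob_eq_oprob out_in_config_iff)
  qed
  have "(THE c. \<exists>t T a A. out_in_config n \<tau> \<alpha> r t T a A \<and> c = out_in_prob p n t T a A) =
      out_in_prob p n t T a A"
    by (rule the_equality) (use assms in blast, use eq in blast)
  moreover have "\<exists>t T a A. out_in_config n \<tau> \<alpha> r t T a A" using assms by blast
  ultimately show ?thesis unfolding N_p_def by simp
qed

text \<open>Allows \<open>N_p\<close> to be read off on sets such as \<open>V - Z\<close>, which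
  need not be initial segments of the naturals.\<close>

lemma oprob_clusters:
  assumes "finite V" "config V t T a A"
  shows "oprob p (arcs_on V) (clusters t T a A) =
    N_p p (card V) (card T) (card A) (card (V - (A \<union> T)))"
proof -
  obtain f where f: "bij_betw f V {1..card V}"
    using ex_bij_betw_nat_finite_1[OF assms(1)] bij_betw_inv by blast
  have "out_in_config (card V) (card T) (card A) (card (V - (A \<union> T))) (f t) (f ` T) (f a) (f ` A)"
    using config_image[OF f assms(2)] by (simp add: out_in_config_iff)
  from out_in_prob_eq_N_p[OF this] show ?thesis
    using oprob_clusters_image[OF f assms, of p] by (simp add: out_in_prob_eq_oprob)
qed

lemma out_prob_eq_d_p:
  assumes "out_config n k s S"
  shows "out_prob p n s S = d_p p n k"
proof -
  have eq: "out_prob p n s' S' = out_prob p n s S" if c: "out_config n k s' S'" for s' S'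
  proof -
    have lab: "card {v \<in> {1..n}. (v = s, v \<in> S) = l} = card {v \<in> {1..n}. (v = s', v \<in> S') = l}" for l
    proof -
      obtain b1 b2 where l: "l = (b1, b2)" by force
      have "{v \<in> {1..n}. (v = s, v \<in> S) = l} =
          (if b1 then (if b2 then {s} else {}) else if b2 then S - {s} else {1..n} - S)"
        if "out_config n k s S" for s S
        using that l by (auto simp: out_config_def)
      then show ?thesis using c assms by (auto simp: out_config_def card_Diff_subset finite_subset)
    qed
    obtain f where f: "bij_betw f {1..n} {1..n}"
      "\<And>v. v \<in> {1..n} \<Longrightarrow> (f v = s', f v \<in> S') = (v = s, v \<in> S)"
      using bij_betw_label_preserving[of "{1..n}" "{1..n}" "\<lambda>v. (v = s, v \<in> S)" "\<lambda>v. (v = s', v \<in> S')"] lab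
      by (metis finite_atLeastAtMost)
    have "f s = s'" using f(2)[of s] assms by (auto simp: out_config_def)
    moreover have "f ` S = S'"
      by (rule image_eq_if_preserved[OF f(1)]) (use c assms f(2) in \<open>auto simp: out_config_def\<close>)
    ultimately show ?thesis
      using oprob_out_cluster_image[OF f(1), of s S p] assms
      by (simp add: out_prob_eq_oprob out_config_def)
  qed
  show ?thesis unfolding d_p_def
    by (rule the_equality[symmetric]) (use assms in blast, use eq in blast)
qed

text \<open>Reversing all arcs turns the in-cluster into an out-cluster; this is how
  \<open>d_p\<close> enters a recursion about in-clusters.\<close>

lemma oprob_in_cluster_all:
  fixes V :: "'v::linorder set"
  assumes "finite V" "v \<in> V"
  shows "oprob p (arcs_on V) (\<lambda>G. in_cluster G v = V) = d_p p (card V) (card V)"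
proof -
  obtain f where f: "bij_betw f V {1..card V}"
    using ex_bij_betw_nat_finite_1[OF assms(1)] bij_betw_inv by blast
  have im: "f ` V = {1..card V}" using f by (simp add: bij_betw_def)
  have "oprob p (arcs_on V) (\<lambda>G. in_cluster G v = V) = oprob p (arcs_on V) (\<lambda>G. out_cluster G v = V)"
    by (subst oprob_converse) (use assms arc_set_arcs_on in \<open>auto simp: in_cluster_converse\<close>)
  also have "\<dots> = out_prob p (card V) (f v) {1..card V}"
    using oprob_out_cluster_image[OF f assms(1) assms(2) order_refl, of p]
    unfolding im out_prob_eq_oprob by simp
  also have "\<dots> = d_p p (card V) (card V)"
    by (rule out_prob_eq_d_p) (use im assms in \<open>auto simp: out_config_def\<close>)
  finally show ?thesis .
qed

end

section \<open>Removing vertices\<close>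

definition cross_arcs :: "'v set \<Rightarrow> 'v set \<Rightarrow> ('v \<times> 'v) set" where
  "cross_arcs V W = V \<times> W \<union> W \<times> V"

lemma arc_set_cross_arcs: "finite V \<Longrightarrow> finite W \<Longrightarrow> V \<inter> W = {} \<Longrightarrow> arc_set (cross_arcs V W)"
  by (auto simp: arc_set_def cross_arcs_def sym_def irrefl_def)

lemma arc_set_Un: "arc_set E \<Longrightarrow> arc_set F \<Longrightarrow> arc_set (E \<union> F)"
  by (auto simp: arc_set_def irrefl_def intro: sym_Un)

lemma oprob_split:
  fixes B Z :: "'v::linorder set"
  assumes "finite B" "finite Z" "B \<inter> Z = {}"
  shows "oprob p (arcs_on (B \<union> Z)) (\<lambda>G. P (G \<inter> B \<times> B) \<and> Q (G \<inter> Z \<times> Z) \<and> R (G \<inter> cross_arcs B Z)) =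
    oprob p (arcs_on B) P * (oprob p (arcs_on Z) Q * oprob p (cross_arcs B Z) R)"
proof -
  let ?E = "arcs_on Z \<union> cross_arcs B Z"
  have E: "arcs_on (B \<union> Z) = arcs_on B \<union> ?E"
    using assms by (auto simp: arcs_on_def cross_arcs_def)
  have arc: "arc_set (arcs_on B)" "arc_set (arcs_on Z)" "arc_set (cross_arcs B Z)"
    using assms arc_set_arcs_on arc_set_cross_arcs by blast+
  have "oprob p (arcs_on (B \<union> Z)) (\<lambda>G. P (G \<inter> B \<times> B) \<and> Q (G \<inter> Z \<times> Z) \<and> R (G \<inter> cross_arcs B Z)) =
    oprob p (arcs_on B \<union> ?E) (\<lambda>G. P (G \<inter> arcs_on B) \<and>
      (\<lambda>G. Q (G \<inter> arcs_on Z) \<and> R (G \<inter> cross_arcs B Z)) (G \<inter> ?E))"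
    unfolding E[symmetric]
  proof (rule oprob_cong)
    fix G assume G: "G \<in> orientations (arcs_on (B \<union> Z))"
    have "G \<inter> ?E \<inter> arcs_on Z = G \<inter> arcs_on Z" "G \<inter> ?E \<inter> cross_arcs B Z = G \<inter> cross_arcs B Z" by auto
    then show "(P (G \<inter> B \<times> B) \<and> Q (G \<inter> Z \<times> Z) \<and> R (G \<inter> cross_arcs B Z)) =
        (P (G \<inter> arcs_on B) \<and> Q (G \<inter> ?E \<inter> arcs_on Z) \<and> R (G \<inter> ?E \<inter> cross_arcs B Z))"
      using restrict_arcs_on[OF G] by simp
  qed
  also have "\<dots> = oprob p (arcs_on B) P *
      oprob p ?E (\<lambda>G. Q (G \<inter> arcs_on Z) \<and> R (G \<inter> cross_arcs B Z))"
    using arc assms by (intro oprob_prod arc_set_Un) (auto simp: arcs_on_def cross_arcs_def)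
  also have "oprob p ?E (\<lambda>G. Q (G \<inter> arcs_on Z) \<and> R (G \<inter> cross_arcs B Z)) =
      oprob p (arcs_on Z) Q * oprob p (cross_arcs B Z) R"
    using arc assms by (intro oprob_prod) (auto simp: arcs_on_def cross_arcs_def)
  finally show ?thesis .
qed

text \<open>The doubly forbidden pairs are those between \<open>V1 \<inter> V2\<close> and
  \<open>W1 \<inter> W2\<close>. Each contributes two arcs to the total count of forbidden arcs,
  hence the subtraction of twice their number in the exponent of y.\<close>

lemma oprob_avoid_cross:
  fixes V W :: "'v::linorder set"
  assumes fin: "finite V" "finite W" and disj: "V \<inter> W = {}"
    and sub: "V1 \<subseteq> V" "V2 \<subseteq> V" "W1 \<subseteq> W" "W2 \<subseteq> W"
  shows "oprob p (cross_arcs V W) (\<lambda>G. G \<inter> (V1 \<times> W1 \<union> W2 \<times> V2) = {}) =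
    (1 - p) ^ (card (V1 \<inter> V2) * card (W1 \<inter> W2)) *
    (1 - p / 2) ^ (card V1 * card W1 + card V2 * card W2 - 2 * (card (V1 \<inter> V2) * card (W1 \<inter> W2)))"
proof -
  let ?F = "V1 \<times> W1 \<union> W2 \<times> V2"
  let ?S = "(V1 \<inter> V2) \<times> (W1 \<inter> W2)"
  have fins: "finite V1" "finite V2" "finite W1" "finite W2"
    using fin sub by (auto intro: finite_subset)
  have both: "?F \<inter> ?F\<inverse> = ?S \<union> ?S\<inverse>" using sub disj by auto
  have "card (?F \<inter> ?F\<inverse>) = card ?S + card (?S\<inverse>)"
    unfolding both using sub disj fins by (intro card_Un_disjoint) auto
  then have c1: "card (?F \<inter> ?F\<inverse>) = 2 * (card (V1 \<inter> V2) * card (W1 \<inter> W2))"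
    by (simp add: card_inverse card_cartesian_product)
  have "card ?F = card (V1 \<times> W1) + card (W2 \<times> V2)"
    using sub disj fins by (intro card_Un_disjoint) auto
  moreover have "?F - ?F\<inverse> = ?F - ?F \<inter> ?F\<inverse>" by auto
  then have "card (?F - ?F\<inverse>) = card ?F - card (?F \<inter> ?F\<inverse>)"
    using fins by (simp only:) (intro card_Diff_subset, auto)
  ultimately have c2: "card (?F - ?F\<inverse>) = card V1 * card W1 + card V2 * card W2 -
      2 * (card (V1 \<inter> V2) * card (W1 \<inter> W2))"
    using c1 by (simp add: card_cartesian_product mult.commute)
  have "?F \<subseteq> cross_arcs V W" using sub by (auto simp: cross_arcs_def)
  then show ?thesis
    using oprob_avoid[OF arc_set_cross_arcs[OF fin disj], of ?F p] unfolding c1 c2 by simp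
qed

context
  fixes p :: real
  assumes p: "0 \<le> p" "p \<le> 1"
begin

text \<open>A vertex of \<open>A \<inter> T\<close> may have no arc to or from an outside vertex,
  which costs a factor q for each of the r outside vertices. A vertex in exactly one of
  \<open>T\<close> and \<open>A\<close> loses one direction, which costs a factor y.\<close>

lemma N_p_restrict:
  fixes V :: "'v::linorder set"
  assumes "finite V" "config V t T a A"
  defines "r \<equiv> card (V - (A \<union> T))"
  shows "N_p p (card V) (card T) (card A) r = N_p p (card V - r) (card T) (card A) 0 *
    (1 - p) ^ (r * card (A \<inter> T)) * (1 - p / 2) ^ (r * (card T + card A - 2 * card (A \<inter> T)))"
proof -
  let ?W = "A \<union> T" and ?R = "V - (A \<union> T)"
  have sub: "T \<subseteq> V" "A \<subseteq> V" using assms by (auto simp: config_def)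
  then have V: "?W \<union> ?R = V" "finite ?W" "finite ?R" "?W \<inter> ?R = {}"
    using finite_subset[OF _ assms(1)] by auto
  have "card V = card ?W + r"
    using card_Un_disjoint[OF V(2-4)] unfolding V(1) r_def .
  then have cW: "card ?W = card V - r" by simp
  have conf: "config ?W t T a A" using assms(2) unfolding config_def by blast
  have "N_p p (card V) (card T) (card A) r = oprob p (arcs_on V) (clusters t T a A)"
    unfolding r_def by (rule oprob_clusters[OF p assms(1,2), symmetric])
  also have "\<dots> = oprob p (arcs_on (?W \<union> ?R)) (\<lambda>G. clusters t T a A (G \<inter> ?W \<times> ?W) \<and> True \<and>
      G \<inter> cross_arcs ?W ?R \<inter> (T \<times> ?R \<union> ?R \<times> A) = {})"
    unfolding V(1)
  proof (rule oprob_cong)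
    fix G assume "G \<in> orientations (arcs_on V)"
    then have G: "G \<subseteq> V \<times> V" by (rule arcs_onD)
    have "T \<times> ?R \<union> ?R \<times> A \<subseteq> cross_arcs ?W ?R" unfolding cross_arcs_def by blast
    then have "G \<inter> cross_arcs ?W ?R \<inter> (T \<times> ?R \<union> ?R \<times> A) = G \<inter> T \<times> ?R \<union> G \<inter> ?R \<times> A"
      by blast
    then have "G \<inter> cross_arcs ?W ?R \<inter> (T \<times> ?R \<union> ?R \<times> A) = {} \<longleftrightarrow>
        G \<inter> T \<times> ?R = {} \<and> G \<inter> ?R \<times> A = {}"
      by simp
    then show "clusters t T a A G = (clusters t T a A (G \<inter> ?W \<times> ?W) \<and> True \<and>
        G \<inter> cross_arcs ?W ?R \<inter> (T \<times> ?R \<union> ?R \<times> A) = {})"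
      using out_cluster_restrict_iff[OF G, of T ?W t] in_cluster_restrict_iff[OF G, of A ?W a]
      unfolding clusters_def by simp blast
  qed
  also have "\<dots> = oprob p (arcs_on ?W) (clusters t T a A) * (oprob p (arcs_on ?R) (\<lambda>G. True) *
      oprob p (cross_arcs ?W ?R) (\<lambda>G. G \<inter> (T \<times> ?R \<union> ?R \<times> A) = {}))"
    by (rule oprob_split) (use V in auto)
  also have "oprob p (arcs_on ?R) (\<lambda>G. True) = 1"
    using V by (intro oprob_True arc_set_arcs_on)
  also have "oprob p (arcs_on ?W) (clusters t T a A) = N_p p (card V - r) (card T) (card A) 0"
    using oprob_clusters[OF p V(2) conf] by (simp add: cW)
  also have "oprob p (cross_arcs ?W ?R) (\<lambda>G. G \<inter> (T \<times> ?R \<union> ?R \<times> A) = {}) =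
      (1 - p) ^ (card (T \<inter> A) * r) * (1 - p / 2) ^ (card T * r + card A * r - 2 * (card (T \<inter> A) * r))"
    using V oprob_avoid_cross[of ?W ?R T A ?R ?R p] by (simp add: r_def)
  finally show ?thesis by (simp add: algebra_simps Int_commute)
qed

text \<open>Common source of (iii) and (iv), with the sum still over sets Z and j arbitrary. The
  first powers of q and y belong to the forbidden arcs at \<open>Z - {v}\<close>. The bracket
  belongs to \<open>v\<close> alone: no arc from \<open>T\<close> to \<open>v\<close>, minus the
  case that \<open>v\<close> also has no arc into \<open>A - Z\<close>.\<close>

lemma N_p_peel:
  fixes V :: "'v::linorder set"
  assumes fin: "finite V" and c: "config V t T a A" and V: "A \<union> T = V"
    and v: "v \<in> A" "v \<notin> T" "v \<noteq> a"
  defines "j \<equiv> card (A \<inter> T)"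
  shows "N_p p (card V) (card T) (card A) 0 =
    (\<Sum>Z | v \<in> Z \<and> Z \<subseteq> A - T - {a}. N_p p (card V - card Z) (card T) (card A - card Z) 0 *
       d_p p (card Z) (card Z) * (1 - p) ^ ((card Z - 1) * j) *
       (1 - p / 2) ^ ((card Z - 1) * (card T + card A - card Z - 2 * j)) *
       ((1 - p / 2) ^ card T - (1 - p / 2) ^ (card T + card A - card Z - 2 * j) * (1 - p) ^ j))"
proof -
  have sub: "T \<subseteq> V" "A \<subseteq> V" "finite A" "finite T" "t \<in> T" "a \<in> A"
    using c fin by (auto simp: config_def intro: finite_subset)
  let ?h = "\<lambda>G. A - in_cluster (G \<inter> (V - {v}) \<times> (V - {v})) a"
  let ?I = "{Z. v \<in> Z \<and> Z \<subseteq> A - T - {a}}"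
  have finI: "finite ?I" using sub by (intro finite_subset[of ?I "Pow A"]) auto
  have "N_p p (card V) (card T) (card A) 0 = oprob p (arcs_on V) (clusters t T a A)"
    using oprob_clusters[OF p fin c] V by simp
  also have "\<dots> = (\<Sum>Z\<in>?I. oprob p (arcs_on V) (\<lambda>G. clusters t T a A G \<and> ?h G = Z))"
  proof (rule oprob_partition)
    fix G assume "G \<in> orientations (arcs_on V)" "clusters t T a A G"
    then show "?h G \<in> ?I"
      using clusters_cut_set[OF arcs_onD sub(1) v, of G t] unfolding clusters_def by blast
  qed (use fin finI in \<open>auto simp: arcs_on_def\<close>)
  also have "\<dots> = (\<Sum>Z\<in>?I. N_p p (card V - card Z) (card T) (card A - card Z) 0 *
       d_p p (card Z) (card Z) * (1 - p) ^ ((card Z - 1) * j) *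
       (1 - p / 2) ^ ((card Z - 1) * (card T + card A - card Z - 2 * j)) *
       ((1 - p / 2) ^ card T - (1 - p / 2) ^ (card T + card A - card Z - 2 * j) * (1 - p) ^ j))"
  proof (rule sum.cong[OF refl])
    fix Z assume "Z \<in> ?I"
    then have Z: "v \<in> Z" "Z \<subseteq> A - T - {a}" "finite Z" using sub by (auto intro: finite_subset)
    let ?B = "V - Z"
    have B: "?B \<union> Z = V" "finite ?B" "?B \<inter> Z = {}" using fin sub Z by auto
    define F where "F = T \<times> Z \<union> (Z - {v}) \<times> (A - Z)"
    define H where "H = {v} \<times> (A - Z)"
    have FH: "F \<subseteq> cross_arcs ?B Z" "H \<subseteq> cross_arcs ?B Z"
      using Z sub v by (auto simp: F_def H_def cross_arcs_def)
    have conf: "config ?B t T a (A - Z)" using c Z by (auto simp: config_def)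
    have cross: "arc_set (cross_arcs ?B Z)" using B Z by (intro arc_set_cross_arcs) auto
    have sets: "T \<inter> (A - Z) = A \<inter> T" "Z \<inter> (Z - {v}) = Z - {v}" using Z by auto
    have "card (A \<inter> T) \<le> card T" "card (A \<inter> T) \<le> card (A - Z)"
      using sub Z by (auto intro!: card_mono)
    \<comment> \<open>Writing \<open>card T = j + b\<close> and
      \<open>card A = Suc m + j + e\<close>, with \<open>card Z = Suc m\<close>, removes the
      truncated subtractions, so that the exponents can be compared as polynomials.\<close>
    then obtain b e where b: "card T = j + b" and e': "card (A - Z) = j + e"
      unfolding j_def by (metis le_iff_add)
    obtain m where m: "card Z = Suc m" using Z by (metis card_0_eq empty_iff old.nat.exhaust)
    have cA: "card (A - Z) = card A - card Z" "card Z \<le> card A"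
      using Z sub card_Diff_subset[of Z A] card_mono[of A Z] by auto
    then have e: "card A = Suc m + j + e" using e' m by simp
    have cards: "card (Z - {v}) = card Z - 1" "card (A - Z) = card A - card Z" "card (A \<inter> T) = j"
      using Z cA by (simp_all add: j_def)
    have "oprob p (arcs_on V) (\<lambda>G. clusters t T a A G \<and> ?h G = Z) =
        oprob p (arcs_on (?B \<union> Z)) (\<lambda>G. clusters t T a (A - Z) (G \<inter> ?B \<times> ?B) \<and>
          in_cluster (G \<inter> Z \<times> Z) v = Z \<and>
          (\<lambda>G. G \<inter> F = {} \<and> \<not> G \<inter> H = {}) (G \<inter> cross_arcs ?B Z))"
      unfolding B(1)
    proof (rule oprob_cong)
      fix G assume "G \<in> orientations (arcs_on V)"
      then have G: "G \<subseteq> V \<times> V" by (rule arcs_onD)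
      have "G \<inter> cross_arcs ?B Z \<inter> F = G \<inter> F" "G \<inter> cross_arcs ?B Z \<inter> H = G \<inter> H"
        using FH by auto
      then show "(clusters t T a A G \<and> ?h G = Z) = (clusters t T a (A - Z) (G \<inter> ?B \<times> ?B) \<and>
          in_cluster (G \<inter> Z \<times> Z) v = Z \<and>
          (\<lambda>G. G \<inter> F = {} \<and> \<not> G \<inter> H = {}) (G \<inter> cross_arcs ?B Z))"
        using clusters_decompose_iff[OF G V[symmetric] sub(5,6) v Z(1,2)]
        unfolding clusters_def F_def H_def by simp
    qed
    also have "\<dots> = oprob p (arcs_on ?B) (clusters t T a (A - Z)) *
        (oprob p (arcs_on Z) (\<lambda>G. in_cluster G v = Z) *
         oprob p (cross_arcs ?B Z) (\<lambda>G. G \<inter> F = {} \<and> \<not> G \<inter> H = {}))"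
      by (rule oprob_split) (use B Z in auto)
    also have "oprob p (arcs_on Z) (\<lambda>G. in_cluster G v = Z) = d_p p (card Z) (card Z)"
      by (rule oprob_in_cluster_all[OF p Z(3,1)])
    also have "oprob p (arcs_on ?B) (clusters t T a (A - Z)) =
        N_p p (card V - card Z) (card T) (card A - card Z) 0"
    proof -
      have "card ?B = card V - card Z" "card (A - Z) = card A - card Z" "?B - (A - Z \<union> T) = {}"
        using card_Diff_subset[OF Z(3)] Z(2) sub(2) V by blast+
      then show ?thesis using oprob_clusters[OF p B(2) conf] by (simp only: card.empty)
    qed
    \<comment> \<open>"At least one arc from \<open>v\<close>" is handled as a complement: avoiding
      \<open>F\<close> minus avoiding \<open>F \<union> H\<close>. The latter union simplifies to a
      pair of products, so \<open>oprob_avoid_cross\<close> applies to both terms.\<close>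
    also have "oprob p (cross_arcs ?B Z) (\<lambda>G. G \<inter> F = {} \<and> \<not> G \<inter> H = {}) =
        oprob p (cross_arcs ?B Z) (\<lambda>G. G \<inter> F = {}) -
        oprob p (cross_arcs ?B Z) (\<lambda>G. G \<inter> (T \<times> Z \<union> Z \<times> (A - Z)) = {})"
    proof -
      have "T \<times> Z \<union> Z \<times> (A - Z) = F \<union> H" using Z by (auto simp: F_def H_def)
      then have "(G \<inter> F = {} \<and> G \<inter> H = {}) = (G \<inter> (T \<times> Z \<union> Z \<times> (A - Z)) = {})" for G
        by auto
      then show ?thesis using oprob_diff[of "cross_arcs ?B Z" p "\<lambda>G. G \<inter> F = {}" "\<lambda>G. G \<inter> H = {}"] cross
        by (simp add: arc_set_def)
    qed
    \<comment> \<open>Doubly forbidden are the pairs between \<open>A \<inter> T\<close> and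
      \<open>Z - {v}\<close>. The remaining singly forbidden pairs number
      \<open>card T + card A - card Z - 2 * j\<close> for each vertex of \<open>Z - {v}\<close>,
      together with \<open>card T\<close> for \<open>v\<close>.\<close>
    also have "oprob p (cross_arcs ?B Z) (\<lambda>G. G \<inter> F = {}) =
        (1 - p) ^ ((card Z - 1) * j) * ((1 - p / 2) ^ ((card Z - 1) * (card T + card A - card Z - 2 * j)) *
        (1 - p / 2) ^ card T)"
    proof -
      have "T \<union> (A - Z) \<subseteq> ?B" using Z sub by auto
      then show ?thesis
        using oprob_avoid_cross[OF B(2) Z(3) B(3), of T "A - Z" Z "Z - {v}" p] Z(1,3)
        unfolding F_def sets(1) sets(2) cards m b e
        by (simp add: algebra_simps flip: power_add)
    qed
    \<comment> \<open>Now \<open>v\<close> is constrained like every other vertex of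
      \<open>Z\<close>, so its j pairs with \<open>A \<inter> T\<close> become doubly forbidden as
      well.\<close>
    also have "oprob p (cross_arcs ?B Z) (\<lambda>G. G \<inter> (T \<times> Z \<union> Z \<times> (A - Z)) = {}) =
        (1 - p) ^ ((card Z - 1) * j) * ((1 - p / 2) ^ ((card Z - 1) * (card T + card A - card Z - 2 * j)) *
        ((1 - p / 2) ^ (card T + card A - card Z - 2 * j) * (1 - p) ^ j))"
    proof -
      have "T \<union> (A - Z) \<subseteq> ?B" using Z sub by auto
      then show ?thesis
        using oprob_avoid_cross[OF B(2) Z(3) B(3), of T "A - Z" Z Z p] Z(1,3)
        unfolding sets(1) Int_absorb cards m b e
        by (simp add: algebra_simps flip: power_add)
    qed
    finally show "oprob p (arcs_on V) (\<lambda>G. clusters t T a A G \<and> ?h G = Z) =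
      N_p p (card V - card Z) (card T) (card A - card Z) 0 *
       d_p p (card Z) (card Z) * (1 - p) ^ ((card Z - 1) * j) *
       (1 - p / 2) ^ ((card Z - 1) * (card T + card A - card Z - 2 * j)) *
       ((1 - p / 2) ^ card T - (1 - p / 2) ^ (card T + card A - card Z - 2 * j) * (1 - p) ^ j)"
      by (simp add: algebra_simps)
  qed
  finally show ?thesis .
qed

end

section \<open>Summation over clusters\<close>

text \<open>Source of every binomial coefficient below: a set between \<open>B\<close> and
  \<open>V\<close> arises from \<open>B\<close> by adding some of the \<open>card V - card B\<close>
  other points.\<close>

lemma sum_subsets_between:
  fixes g :: "nat \<Rightarrow> real"
  assumes "finite V" "B \<subseteq> V"
  shows "(\<Sum>S | B \<subseteq> S \<and> S \<subseteq> V. g (card S)) =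
    (\<Sum>k=card B..card V. real ((card V - card B) choose (k - card B)) * g k)"
proof -
  let ?I = "{S. B \<subseteq> S \<and> S \<subseteq> V}"
  have fin: "finite ?I" "finite B" using assms by (auto intro: finite_subset)
  have "(\<Sum>S\<in>?I. g (card S)) = (\<Sum>k=card B..card V. \<Sum>S\<in>{S \<in> ?I. card S = k}. g (card S))"
    using fin assms finite_subset[OF _ assms(1)] by (intro sum.group[symmetric]) (auto intro!: card_mono)
  also have "\<dots> = (\<Sum>k=card B..card V. real ((card V - card B) choose (k - card B)) * g k)"
  proof (rule sum.cong[OF refl])
    fix k assume k: "k \<in> {card B..card V}"
    have "bij_betw (\<lambda>U. B \<union> U) {U. U \<subseteq> V - B \<and> card U = k - card B} {S \<in> ?I. card S = k}"
    proof (rule bij_betw_byWitness[where f' = "\<lambda>S. S - B"])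
      show "(\<lambda>U. B \<union> U) ` {U. U \<subseteq> V - B \<and> card U = k - card B} \<subseteq> {S \<in> ?I. card S = k}"
      proof
        fix S assume "S \<in> (\<lambda>U. B \<union> U) ` {U. U \<subseteq> V - B \<and> card U = k - card B}"
        then obtain U where U: "S = B \<union> U" "U \<subseteq> V - B" "card U = k - card B" by auto
        then have "finite U" "B \<inter> U = {}" using finite_subset[OF U(2)] assms(1) by auto
        then have "card S = card B + card U" using U(1) fin(2) by (simp add: card_Un_disjoint)
        then show "S \<in> {S \<in> ?I. card S = k}" using U k assms by auto
      qed
      show "(\<lambda>S. S - B) ` {S \<in> ?I. card S = k} \<subseteq> {U. U \<subseteq> V - B \<and> card U = k - card B}"
        using fin by (auto simp: card_Diff_subset)
    qed auto
    then have "card {S \<in> ?I. card S = k} = (card V - card B) choose (k - card B)"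
      using assms fin by (simp add: bij_betw_same_card[symmetric] n_subsets card_Diff_subset)
    then show "(\<Sum>S\<in>{S \<in> ?I. card S = k}. g (card S)) =
        real ((card V - card B) choose (k - card B)) * g k" by simp
  qed
  finally show ?thesis .
qed

lemma out_in_config_swap:
  "out_in_config n \<tau> \<alpha> r t T a A \<longleftrightarrow> out_in_config n \<alpha> \<tau> r a A t T"
  by (auto simp: out_in_config_def Un_commute)

lemma card_config:
  assumes "finite V" "config V t T a A"
  shows "card T + card A = card (A \<union> T) + card (A \<inter> T)"
    and "card V = card (V - (A \<union> T)) + card (A \<union> T)"
proof -
  have sub: "A \<union> T \<subseteq> V" "finite A" "finite T"
    using assms by (auto simp: config_def intro: finite_subset)
  show "card T + card A = card (A \<union> T) + card (A \<inter> T)"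
    using card_Un_Int[OF sub(2,3)] by simp
  show "card V = card (V - (A \<union> T)) + card (A \<union> T)"
    using sub assms card_mono[of V "A \<union> T"] by (simp add: card_Diff_subset)
qed

section \<open>The identities (i) to (v)\<close>

context
  fixes p :: real
  assumes p: "0 \<le> p" "p \<le> 1"
begin

lemma N_p_eq_0:
  assumes "\<And>t T a A. \<not> out_in_config n \<tau> \<alpha> r t T a A"
  shows "N_p p n \<tau> \<alpha> r = 0"
  unfolding N_p_def by (rule if_not_P) (use assms in blast)

lemma N_p_swap: "N_p p n \<tau> \<alpha> r = N_p p n \<alpha> \<tau> r"
proof (cases "\<exists>t T a A. out_in_config n \<tau> \<alpha> r t T a A")
  case True
  then obtain t T a A where c: "out_in_config n \<tau> \<alpha> r t T a A" by blast
  have "clusters t T a A (G\<inverse>) = clusters a A t T G" for G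
    by (auto simp: clusters_def in_cluster_converse)
  then have "out_in_prob p n t T a A = out_in_prob p n a A t T"
    unfolding out_in_prob_eq_oprob[OF p]
    using oprob_converse[OF arc_set_arcs_on[of "{1..n}"], of p "clusters t T a A"] by simp
  then show ?thesis
    using out_in_prob_eq_N_p[OF p c] out_in_prob_eq_N_p[OF p c[THEN out_in_config_swap[THEN iffD1]]] by simp
next
  case False
  then have "\<not> out_in_config n \<tau> \<alpha> r t T a A" "\<not> out_in_config n \<alpha> \<tau> r t T a A" for t T a A
    using out_in_config_swap by blast+
  then have "N_p p n \<tau> \<alpha> r = 0" "N_p p n \<alpha> \<tau> r = 0" by (intro N_p_eq_0; blast)+
  then show ?thesis by simp
qed

lemma N_p_reduce:
  assumes "r \<le> n" "n \<le> r + \<tau> + \<alpha>"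
  shows "N_p p n \<tau> \<alpha> r = N_p p (n - r) \<tau> \<alpha> 0 *
    (1 - p) ^ (r * (r + \<tau> + \<alpha> - n)) * (1 - p / 2) ^ (r * (2 * n - 2 * r - \<tau> - \<alpha>))"
proof (cases "\<exists>t T a A. out_in_config n \<tau> \<alpha> r t T a A")
  case True
  then obtain t T a A where c: "config {1..n} t T a A" "card T = \<tau>" "card A = \<alpha>"
    "card ({1..n} - (A \<union> T)) = r"
    unfolding out_in_config_iff by blast
  have "card (A \<inter> T) = r + \<tau> + \<alpha> - n" "\<tau> + \<alpha> - 2 * card (A \<inter> T) = 2 * n - 2 * r - \<tau> - \<alpha>"
    using card_config[OF _ c(1)] c(2-4) by auto
  then show ?thesis using N_p_restrict[OF p _ c(1)] c(2-4) by simp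
next
  case False
  \<comment> \<open>Both sides must vanish here. A choice of sets covering \<open>{1..n - r}\<close>
    is also one in \<open>{1..n}\<close> with exactly r uncovered vertices, so the absence of the
    latter excludes the former.\<close>
  have "\<not> out_in_config (n - r) \<tau> \<alpha> 0 t T a A" for t T a A
  proof
    assume c: "out_in_config (n - r) \<tau> \<alpha> 0 t T a A"
    then have "A \<union> T = {1..n - r}" by (auto simp: out_in_config_def)
    then have "{1..n} - (A \<union> T) = {1..n} - {1..n - r}" by (rule arg_cong)
    also have "\<dots> = {n - r + 1..n}" by auto
    finally have "card ({1..n} - (A \<union> T)) = r" using assms(1) by simp
    moreover have "{1..n - r} \<subseteq> {1..n}" by simp
    ultimately have "out_in_config n \<tau> \<alpha> r t T a A"
      using c unfolding out_in_config_def by blast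
    then show False using False by blast
  qed
  then show ?thesis using False by (simp add: N_p_eq_0)
qed

lemma N_p_recursion_meet:
  assumes "\<tau> \<ge> 1" "n > \<tau>" "n \<ge> \<alpha>" "\<tau> + \<alpha> \<ge> n + 2"
  shows "N_p p n \<tau> \<alpha> 0 =
    (\<Sum>\<zeta>=1..n - \<tau>. real ((n - \<tau> - 1) choose (\<zeta> - 1)) * N_p p (n - \<zeta>) \<tau> (\<alpha> - \<zeta>) 0 * d_p p \<zeta> \<zeta> *
       (1 - p) ^ ((\<zeta> - 1) * (\<alpha> + \<tau> - n)) * (1 - p / 2) ^ ((\<zeta> - 1) * (2 * n - \<tau> - \<alpha> - \<zeta>)) *
       ((1 - p / 2) ^ \<tau> - (1 - p / 2) ^ (2 * n - \<alpha> - \<tau> - \<zeta>) * (1 - p) ^ (\<alpha> + \<tau> - n)))"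
    (is "_ = (\<Sum>\<zeta>=1..n - \<tau>. ?f \<zeta>)")
proof -
  \<comment> \<open>An initial and a final segment with overlap
    \<open>{n - \<alpha> + 1..\<tau>}\<close>. It has at least two points, so it contains t =
    \<open>\<tau>\<close> and a = \<open>\<tau> - 1\<close>; the removed vertex v = n is outside
    \<open>?T\<close>. As a lies in \<open>?T\<close>, all \<open>n - \<tau>\<close> vertices of
    \<open>?A - ?T\<close> may belong to Z.\<close>
  let ?V = "{1..n}" and ?T = "{1..\<tau>}" and ?A = "{n - \<alpha> + 1..n}"
  have c: "config ?V \<tau> ?T (\<tau> - 1) ?A" using assms by (auto simp: config_def)
  have un: "?A \<union> ?T = ?V" using assms by auto
  have W: "?A - ?T - {\<tau> - 1} = {\<tau> + 1..n}" using assms by auto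
  have cards: "card ?A = \<alpha>" "card ?T = \<tau>" "card ?V = n" using assms by auto
  have "?A \<inter> ?T = {n - \<alpha> + 1..\<tau>}" using assms by auto
  then have j: "card (?A \<inter> ?T) = \<alpha> + \<tau> - n" using assms by simp
  have "\<tau> + \<alpha> - z - 2 * (\<alpha> + \<tau> - n) = 2 * n - \<tau> - \<alpha> - z" "2 * n - \<alpha> - \<tau> - z = 2 * n - \<tau> - \<alpha> - z" for z
    using assms by auto
  then have "N_p p n \<tau> \<alpha> 0 =
    (\<Sum>Z | {n} \<subseteq> Z \<and> Z \<subseteq> {\<tau> + 1..n}. N_p p (n - card Z) \<tau> (\<alpha> - card Z) 0 *
       d_p p (card Z) (card Z) * (1 - p) ^ ((card Z - 1) * (\<alpha> + \<tau> - n)) *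
       (1 - p / 2) ^ ((card Z - 1) * (2 * n - \<tau> - \<alpha> - card Z)) *
       ((1 - p / 2) ^ \<tau> - (1 - p / 2) ^ (2 * n - \<alpha> - \<tau> - card Z) * (1 - p) ^ (\<alpha> + \<tau> - n)))"
    using N_p_peel[OF p finite_atLeastAtMost c un, of n, unfolded cards j W] assms by simp
  also have "\<dots> = (\<Sum>\<zeta>=card {n}..card {\<tau> + 1..n}.
      real ((card {\<tau> + 1..n} - card {n}) choose (\<zeta> - card {n})) *
      (N_p p (n - \<zeta>) \<tau> (\<alpha> - \<zeta>) 0 * d_p p \<zeta> \<zeta> * (1 - p) ^ ((\<zeta> - 1) * (\<alpha> + \<tau> - n)) *
       (1 - p / 2) ^ ((\<zeta> - 1) * (2 * n - \<tau> - \<alpha> - \<zeta>)) *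
       ((1 - p / 2) ^ \<tau> - (1 - p / 2) ^ (2 * n - \<alpha> - \<tau> - \<zeta>) * (1 - p) ^ (\<alpha> + \<tau> - n))))"
    by (rule sum_subsets_between) (use assms in auto)
  also have "\<dots> = (\<Sum>\<zeta>=1..n - \<tau>. ?f \<zeta>)"
    by (intro sum.cong) (simp_all add: mult.assoc)
  finally show ?thesis .
qed

lemma N_p_recursion_disjoint:
  assumes "\<tau> \<ge> 1" "\<alpha> \<ge> 2" "n = \<tau> + \<alpha>"
  shows "N_p p n \<tau> \<alpha> 0 =
    (\<Sum>\<zeta>=1..\<alpha> - 1. real ((\<alpha> - 2) choose (\<zeta> - 1)) * N_p p (n - \<zeta>) \<tau> (\<alpha> - \<zeta>) 0 * d_p p \<zeta> \<zeta> *
       (1 - p / 2) ^ ((\<zeta> - 1) * (\<tau> + \<alpha> - \<zeta>)) * (1 - p / 2) ^ \<tau> * (1 - (1 - p / 2) ^ (\<alpha> - \<zeta>)))"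
    (is "_ = (\<Sum>\<zeta>=1..\<alpha> - 1. ?f \<zeta>)")
proof -
  \<comment> \<open>Now a = \<open>\<tau> + 1\<close> lies outside \<open>?T\<close> and has to be
    kept out of Z. Only \<open>\<alpha> - 1\<close> candidates remain, among them the obligatory v =
    n, whence \<open>(\<alpha> - 2) choose (\<zeta> - 1)\<close>; v and a differ because
    \<open>\<alpha> \<ge> 2\<close>.\<close>
  let ?V = "{1..n}" and ?T = "{1..\<tau>}" and ?A = "{\<tau> + 1..n}"
  have c: "config ?V 1 ?T (\<tau> + 1) ?A" using assms by (auto simp: config_def)
  have un: "?A \<union> ?T = ?V" using assms by auto
  have W: "?A - ?T - {\<tau> + 1} = {\<tau> + 2..n}" using assms by auto
  have cards: "card ?A = \<alpha>" "card ?T = \<tau>" "card ?V = n" using assms by auto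
  have "?A \<inter> ?T = {}" using assms by auto
  then have j: "card (?A \<inter> ?T) = 0" by simp
  have cW: "card {\<tau> + 2..n} = \<alpha> - 1" using assms by simp
  have "N_p p n \<tau> \<alpha> 0 =
    (\<Sum>Z | {n} \<subseteq> Z \<and> Z \<subseteq> {\<tau> + 2..n}. N_p p (n - card Z) \<tau> (\<alpha> - card Z) 0 *
       d_p p (card Z) (card Z) * (1 - p / 2) ^ ((card Z - 1) * (\<tau> + \<alpha> - card Z)) *
       ((1 - p / 2) ^ \<tau> - (1 - p / 2) ^ (\<tau> + \<alpha> - card Z)))"
    using N_p_peel[OF p finite_atLeastAtMost c un, of n, unfolded cards j W] assms by simp
  also have "\<dots> = (\<Sum>\<zeta>=card {n}..card {\<tau> + 2..n}.
      real ((card {\<tau> + 2..n} - card {n}) choose (\<zeta> - card {n})) *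
      (N_p p (n - \<zeta>) \<tau> (\<alpha> - \<zeta>) 0 * d_p p \<zeta> \<zeta> * (1 - p / 2) ^ ((\<zeta> - 1) * (\<tau> + \<alpha> - \<zeta>)) *
       ((1 - p / 2) ^ \<tau> - (1 - p / 2) ^ (\<tau> + \<alpha> - \<zeta>))))"
    by (rule sum_subsets_between) (use assms in auto)
  also have "\<dots> = (\<Sum>\<zeta>=1..\<alpha> - 1. ?f \<zeta>)"
  proof (rule sum.cong)
    fix \<zeta> assume "\<zeta> \<in> {1..\<alpha> - 1}"
    then have "\<tau> + \<alpha> - \<zeta> = \<tau> + (\<alpha> - \<zeta>)" by auto
    then have "(1 - p / 2) ^ (\<tau> + \<alpha> - \<zeta>) = (1 - p / 2) ^ \<tau> * (1 - p / 2) ^ (\<alpha> - \<zeta>)"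
      by (simp add: power_add)
    then show "real ((card {\<tau> + 2..n} - card {n}) choose (\<zeta> - card {n})) *
      (N_p p (n - \<zeta>) \<tau> (\<alpha> - \<zeta>) 0 * d_p p \<zeta> \<zeta> * (1 - p / 2) ^ ((\<zeta> - 1) * (\<tau> + \<alpha> - \<zeta>)) *
       ((1 - p / 2) ^ \<tau> - (1 - p / 2) ^ (\<tau> + \<alpha> - \<zeta>))) = ?f \<zeta>"
      unfolding cW by (simp add: right_diff_distrib mult.assoc numeral_2_eq_2)
  qed (use assms(3) in simp)
  finally show ?thesis .
qed

text \<open>For fixed t and a the pairs of clusters are classified by J =
  \<open>A \<inter> T\<close>. If J is nonempty it contains both t and a, so j starts at 2 and the
  other members of J come from n - 2 vertices. The number of uncovered vertices is written
  \<open>n + j - \<alpha> - \<tau>\<close> since \<open>n - \<alpha> - \<tau>\<close> could truncate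
  when the clusters overlap.\<close>

lemma N_p_total:
  assumes "n \<ge> 2"
  shows "1 = (\<Sum>j=2..n. real ((n - 2) choose (j - 2)) *
      (\<Sum>\<tau>=j..n. real ((n - j) choose (\<tau> - j)) *
        (\<Sum>\<alpha>=j..n - \<tau> + j. real ((n - \<tau>) choose (\<alpha> - j)) * N_p p n \<tau> \<alpha> (n + j - \<alpha> - \<tau>)))) +
    (\<Sum>\<tau>=1..n - 1. real ((n - 2) choose (\<tau> - 1)) *
      (\<Sum>\<alpha>=1..n - \<tau>. real ((n - \<tau> - 1) choose (\<alpha> - 1)) * N_p p n \<tau> \<alpha> (n - \<alpha> - \<tau>)))"
proof -
  define V where "V = {1..n}"
  define t a where "t = n" and "a = n - 1"
  have V: "finite V" "card V = n" "t \<in> V" "a \<in> V" "a \<noteq> t"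
    using assms by (auto simp: V_def t_def a_def)
  define C where "C = {(T, A). config V t T a A}"
  define C0 where "C0 = {(T, A). config V t T a A \<and> A \<inter> T = {}}"
  define C1 where "C1 = {(T, A). config V t T a A \<and> A \<inter> T \<noteq> {}}"
  define f where "f = (\<lambda>(T, A). N_p p n (card T) (card A) (card (V - (A \<union> T))))"
  have finC: "finite C"
    by (rule finite_subset[of _ "Pow V \<times> Pow V"]) (use V in \<open>auto simp: C_def config_def\<close>)
  then have finC': "finite C0" "finite C1"
    by (auto simp: C_def C0_def C1_def elim!: finite_subset[rotated])
  have "1 = oprob p (arcs_on V) (\<lambda>G. True)"
    using V by (intro oprob_True[symmetric] arc_set_arcs_on)
  also have "\<dots> = (\<Sum>c\<in>C. oprob p (arcs_on V) (\<lambda>G. True \<and> (out_cluster G t, in_cluster G a) = c))"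
  proof (rule oprob_partition)
    fix G assume "G \<in> orientations (arcs_on V)"
    then show "(out_cluster G t, in_cluster G a) \<in> C"
      using clusters_imp_config[of t _ a _ G V] arcs_onD V by (auto simp: C_def clusters_def)
  qed (use V finC in \<open>auto simp: arcs_on_def\<close>)
  also have "\<dots> = sum f C"
  proof (rule sum.cong[OF refl])
    fix c assume "c \<in> C"
    then obtain T A where "c = (T, A)" "config V t T a A" by (auto simp: C_def)
    moreover have "clusters t T a A = (\<lambda>G. out_cluster G t = T \<and> in_cluster G a = A)"
      by (simp add: clusters_def fun_eq_iff)
    ultimately show "oprob p (arcs_on V) (\<lambda>G. True \<and> (out_cluster G t, in_cluster G a) = c) = f c"
      using oprob_clusters[OF p V(1), of t T a A] V(2) by (simp add: f_def)
  qed
  also have "C = C1 \<union> C0" by (auto simp: C_def C0_def C1_def)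
  also have "sum f (C1 \<union> C0) = sum f C1 + sum f C0"
    using finC' by (intro sum.union_disjoint) (auto simp: C0_def C1_def)
  also have "sum f C0 = (\<Sum>\<tau>=1..n - 1. real ((n - 2) choose (\<tau> - 1)) *
      (\<Sum>\<alpha>=1..n - \<tau>. real ((n - \<tau> - 1) choose (\<alpha> - 1)) * N_p p n \<tau> \<alpha> (n - \<alpha> - \<tau>)))"
  proof -
    \<comment> \<open>Disjointness is encoded by choosing \<open>T\<close> without a first and then
      \<open>A\<close> within the complement of \<open>T\<close>.\<close>
    have "C0 = Sigma {T. {t} \<subseteq> T \<and> T \<subseteq> V - {a}} (\<lambda>T. {A. {a} \<subseteq> A \<and> A \<subseteq> V - T})"
      using V by (auto simp: C0_def config_def)
    then have "sum f C0 = (\<Sum>T | {t} \<subseteq> T \<and> T \<subseteq> V - {a}. \<Sum>A | {a} \<subseteq> A \<and> A \<subseteq> V - T. f (T, A))"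
      using V by (simp add: sum.Sigma)
    also have "\<dots> = (\<Sum>T | {t} \<subseteq> T \<and> T \<subseteq> V - {a}. \<Sum>\<alpha>=1..n - card T.
        real ((n - card T - 1) choose (\<alpha> - 1)) * N_p p n (card T) \<alpha> (n - \<alpha> - card T))"
    proof (rule sum.cong[OF refl])
      fix T assume "T \<in> {T. {t} \<subseteq> T \<and> T \<subseteq> V - {a}}"
      then have T: "T \<subseteq> V" "a \<notin> T" "finite T" using V by (auto intro: finite_subset)
      have "(\<Sum>A | {a} \<subseteq> A \<and> A \<subseteq> V - T. f (T, A)) =
          (\<Sum>A | {a} \<subseteq> A \<and> A \<subseteq> V - T. N_p p n (card T) (card A) (n - card A - card T))"
      proof (rule sum.cong[OF refl])
        fix A assume "A \<in> {A. {a} \<subseteq> A \<and> A \<subseteq> V - T}"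
        then have A: "A \<subseteq> V" "A \<inter> T = {}" "finite A" using V by (auto intro: finite_subset)
        then have "card (V - (A \<union> T)) = n - card A - card T"
          using T V by (simp add: card_Diff_subset card_Un_disjoint)
        then show "f (T, A) = N_p p n (card T) (card A) (n - card A - card T)" by (simp add: f_def)
      qed
      then show "(\<Sum>A | {a} \<subseteq> A \<and> A \<subseteq> V - T. f (T, A)) = (\<Sum>\<alpha>=1..n - card T.
        real ((n - card T - 1) choose (\<alpha> - 1)) * N_p p n (card T) \<alpha> (n - \<alpha> - card T))"
        using sum_subsets_between[of "V - T" "{a}" "\<lambda>\<alpha>. N_p p n (card T) \<alpha> (n - \<alpha> - card T)"] T V
        by (simp add: card_Diff_subset)
    qed
    also have "\<dots> = (\<Sum>\<tau>=card {t}..card (V - {a}).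
      real ((card (V - {a}) - card {t}) choose (\<tau> - card {t})) *
      (\<Sum>\<alpha>=1..n - \<tau>. real ((n - \<tau> - 1) choose (\<alpha> - 1)) * N_p p n \<tau> \<alpha> (n - \<alpha> - \<tau>)))"
      by (rule sum_subsets_between) (use V in auto)
    finally show ?thesis using V by (simp add: numeral_2_eq_2)
  qed
  also have "sum f C1 = (\<Sum>j=2..n. real ((n - 2) choose (j - 2)) *
      (\<Sum>\<tau>=j..n. real ((n - j) choose (\<tau> - j)) *
        (\<Sum>\<alpha>=j..n - \<tau> + j. real ((n - \<tau>) choose (\<alpha> - j)) * N_p p n \<tau> \<alpha> (n + j - \<alpha> - \<tau>))))"
  proof -
    let ?I = "{J. {a, t} \<subseteq> J \<and> J \<subseteq> V}"
    have "sum f C1 = (\<Sum>J\<in>?I. sum f {c \<in> C1. (\<lambda>(T, A). A \<inter> T) c = J})"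
      by (rule sum.group[symmetric]) (use V finC' in \<open>auto simp: C1_def config_def\<close>)
    also have "\<dots> = (\<Sum>J\<in>?I. \<Sum>\<tau>=card J..n. real ((n - card J) choose (\<tau> - card J)) *
        (\<Sum>\<alpha>=card J..n - \<tau> + card J. real ((n - \<tau>) choose (\<alpha> - card J)) *
          N_p p n \<tau> \<alpha> (n + card J - \<alpha> - \<tau>)))"
    proof (rule sum.cong[OF refl])
      fix J assume "J \<in> ?I"
      then have J: "a \<in> J" "t \<in> J" "J \<subseteq> V" "finite J" using V by (auto intro: finite_subset)
      \<comment> \<open>With the intersection fixed as J, choose \<open>T\<close> above J, then let
        \<open>A\<close> add to J only vertices outside \<open>T\<close>.\<close>
      have "{c \<in> C1. (\<lambda>(T, A). A \<inter> T) c = J} =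
          Sigma {T. J \<subseteq> T \<and> T \<subseteq> V} (\<lambda>T. {A. J \<subseteq> A \<and> A \<subseteq> V - T \<union> J})"
        using V J by (auto simp: C1_def config_def)
      then have "sum f {c \<in> C1. (\<lambda>(T, A). A \<inter> T) c = J} =
          (\<Sum>T | J \<subseteq> T \<and> T \<subseteq> V. \<Sum>A | J \<subseteq> A \<and> A \<subseteq> V - T \<union> J. f (T, A))"
        using V J by (simp add: sum.Sigma)
      also have "\<dots> = (\<Sum>T | J \<subseteq> T \<and> T \<subseteq> V. \<Sum>\<alpha>=card J..n - card T + card J.
          real ((n - card T) choose (\<alpha> - card J)) * N_p p n (card T) \<alpha> (n + card J - \<alpha> - card T))"
      proof (rule sum.cong[OF refl])
        fix T assume "T \<in> {T. J \<subseteq> T \<and> T \<subseteq> V}"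
        then have T: "J \<subseteq> T" "T \<subseteq> V" "finite T" using V by (auto intro: finite_subset)
        have "(\<Sum>A | J \<subseteq> A \<and> A \<subseteq> V - T \<union> J. f (T, A)) =
            (\<Sum>A | J \<subseteq> A \<and> A \<subseteq> V - T \<union> J. N_p p n (card T) (card A) (n + card J - card A - card T))"
        proof (rule sum.cong[OF refl])
          fix A assume "A \<in> {A. J \<subseteq> A \<and> A \<subseteq> V - T \<union> J}"
          then have A: "A \<subseteq> V" "A \<inter> T = J" "finite A" using V J T by (auto intro: finite_subset)
          have "card A + card T = card (A \<union> T) + card J" using card_Un_Int[OF A(3) T(3)] A by simp
          then have "card (V - (A \<union> T)) = n + card J - card A - card T"
            using A T V by (simp add: card_Diff_subset)
          then show "f (T, A) = N_p p n (card T) (card A) (n + card J - card A - card T)"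
            by (simp add: f_def)
        qed
        moreover have "card (V - T \<union> J) = n - card T + card J"
          using T V J by (subst card_Un_disjoint) (auto simp: card_Diff_subset)
        ultimately show "(\<Sum>A | J \<subseteq> A \<and> A \<subseteq> V - T \<union> J. f (T, A)) =
          (\<Sum>\<alpha>=card J..n - card T + card J.
            real ((n - card T) choose (\<alpha> - card J)) * N_p p n (card T) \<alpha> (n + card J - \<alpha> - card T))"
          using sum_subsets_between[of "V - T \<union> J" J "\<lambda>\<alpha>. N_p p n (card T) \<alpha> (n + card J - \<alpha> - card T)"] V J
          by simp
      qed
      also have "\<dots> = (\<Sum>\<tau>=card J..n. real ((n - card J) choose (\<tau> - card J)) *
        (\<Sum>\<alpha>=card J..n - \<tau> + card J. real ((n - \<tau>) choose (\<alpha> - card J)) *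
          N_p p n \<tau> \<alpha> (n + card J - \<alpha> - \<tau>)))"
        using sum_subsets_between[of V J "\<lambda>\<tau>. \<Sum>\<alpha>=card J..n - \<tau> + card J.
          real ((n - \<tau>) choose (\<alpha> - card J)) * N_p p n \<tau> \<alpha> (n + card J - \<alpha> - \<tau>)"] V J by simp
      finally show "sum f {c \<in> C1. (\<lambda>(T, A). A \<inter> T) c = J} =
        (\<Sum>\<tau>=card J..n. real ((n - card J) choose (\<tau> - card J)) *
        (\<Sum>\<alpha>=card J..n - \<tau> + card J. real ((n - \<tau>) choose (\<alpha> - card J)) *
          N_p p n \<tau> \<alpha> (n + card J - \<alpha> - \<tau>)))" .
    qed
    also have "\<dots> = (\<Sum>j=card {a, t}..card V. real ((card V - card {a, t}) choose (j - card {a, t})) *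
      (\<Sum>\<tau>=j..n. real ((n - j) choose (\<tau> - j)) *
        (\<Sum>\<alpha>=j..n - \<tau> + j. real ((n - \<tau>) choose (\<alpha> - j)) * N_p p n \<tau> \<alpha> (n + j - \<alpha> - \<tau>))))"
      by (rule sum_subsets_between) (use V in auto)
    finally have total: "sum f C1 = \<dots>" .
    have "card {a, t} = 2" using V(5) by simp
    then show ?thesis unfolding total V(2) by (simp only:)
  qed
  finally show ?thesis .
qed

text \<open>The term j = n forces \<open>\<tau>\<close> = \<open>\<alpha>\<close> = n with
  coefficient 1, so it is the unknown on the left. Extending the disjoint sum to
  \<open>\<tau>\<close> = n adds nothing, since its inner sum is empty.\<close>

lemma N_p_full:
  assumes "n \<ge> 2"
  shows "N_p p n n n 0 =
        1 - (\<Sum>j=2..n - 1. real ((n - 2) choose (j - 2)) *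
               (\<Sum>\<tau>=j..n. real ((n - j) choose (\<tau> - j)) *
                 (\<Sum>\<alpha>=j..n - \<tau> + j. real ((n - \<tau>) choose (\<alpha> - j)) * N_p p n \<tau> \<alpha> (n + j - \<alpha> - \<tau>))))
          - (\<Sum>\<tau>=1..n. real ((n - 2) choose (\<tau> - 1)) *
               (\<Sum>\<alpha>=1..n - \<tau>. real ((n - \<tau> - 1) choose (\<alpha> - 1)) * N_p p n \<tau> \<alpha> (n - \<alpha> - \<tau>)))"
proof -
  obtain m where m: "n = Suc m" "m \<ge> 1" using assms by (cases n) auto
  have "(\<Sum>j=2..n. F j) = (\<Sum>j=2..n - 1. F j) + F n" "(\<Sum>j=1..n. F j) = (\<Sum>j=1..n - 1. F j) + F n"
    for F :: "nat \<Rightarrow> real"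
    using m by simp_all
  then show ?thesis using N_p_total[OF assms] by simp
qed

section \<open>Initial values and configurations of probability zero\<close>

lemma d_p_1_1: "d_p p 1 1 = 1"
proof -
  have E: "arcs_on {1 :: nat} = {}" by (auto simp: arcs_on_def)
  have "out_config 1 1 1 {1}" by (simp add: out_config_def)
  then have "d_p p 1 1 = oprob p {} (\<lambda>G. out_cluster G (1 :: nat) = {1})"
    using out_prob_eq_d_p[OF p] out_prob_eq_oprob[OF p] E by fastforce
  also have "\<dots> = oprob p {} (\<lambda>G :: (nat \<times> nat) set. True)"
    by (rule oprob_cong) (auto simp: orientations_def out_cluster_def)
  also have "\<dots> = 1" by (rule oprob_True) (simp add: arc_set_def)
  finally show ?thesis .
qed

lemma arcs_on_two: "arcs_on {1..2 :: nat} = {(1, 2), (2, 1)}"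
  by (auto simp: arcs_on_def)

lemma oprob_two_avoid: "oprob p (arcs_on {1..2 :: nat}) (\<lambda>G. G \<inter> {(1, 2)} = {}) = 1 - p / 2"
proof -
  have "{(1 :: nat, 2 :: nat)} - {(1, 2)}\<inverse> = {(1, 2)}" "{(1 :: nat, 2 :: nat)} \<inter> {(1, 2)}\<inverse> = {}" by auto
  then show ?thesis
    using oprob_avoid[OF arc_set_arcs_on[of "{1..2 :: nat}"], of "{(1, 2)}" p] arcs_on_two by simp
qed

text \<open>The arc from 2 to 1 enters the source of the out-cluster and leaves the target of the
  in-cluster, so it influences neither; only the arc from 1 to 2 matters.\<close>

lemma clusters_two:
  fixes G :: "(nat \<times> nat) set"
  assumes "G \<in> orientations (arcs_on {1..2})"
  shows "clusters 1 {1, 2} 2 {1, 2} G \<longleftrightarrow> G \<inter> {(1, 2)} \<noteq> {}"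
    and "clusters 1 {1} 2 {2} G \<longleftrightarrow> G \<inter> {(1, 2)} = {}"
proof -
  have G: "G \<subseteq> {1, 2} \<times> {1, 2}" using arcs_onD[OF assms] by (auto simp: atLeastAtMost_insertL numeral_2_eq_2)
  have 1: "clusters 1 {1, 2} 2 {1, 2} G" if "(1, 2) \<in> G"
  proof -
    have "out_cluster G 1 \<subseteq> {1, 2}" "in_cluster G 2 \<subseteq> {1, 2}"
      using G by (intro out_cluster_least in_cluster_least; auto)+
    moreover have "2 \<in> out_cluster G 1" "1 \<in> in_cluster G 2"
      using that by (auto simp: out_cluster_def in_cluster_def)
    ultimately show ?thesis using out_cluster_self[of 1 G] in_cluster_self[of 2 G]
      unfolding clusters_def by blast
  qed
  have 2: "clusters 1 {1} 2 {2} G" if "(1, 2) \<notin> G"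
  proof -
    have "out_cluster G 1 \<subseteq> {1}" "in_cluster G 2 \<subseteq> {2}"
      using G that assms
      by (intro out_cluster_least in_cluster_least; auto simp: orientations_def arcs_on_def; blast)+
    then show ?thesis using out_cluster_self[of 1 G] in_cluster_self[of 2 G]
      unfolding clusters_def by blast
  qed
  have "{1 :: nat} \<noteq> {1, 2}" by auto
  then show "clusters 1 {1, 2} 2 {1, 2} G \<longleftrightarrow> G \<inter> {(1, 2)} \<noteq> {}"
    "clusters 1 {1} 2 {2} G \<longleftrightarrow> G \<inter> {(1, 2)} = {}"
    using 1 2 unfolding clusters_def by auto
qed

lemma N_p_two: "N_p p 2 2 2 0 = p / 2" "N_p p 2 1 1 0 = 1 - p / 2"
proof -
  have two: "{1..2 :: nat} = {1, 2}" by auto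
  have "out_in_config 2 2 2 0 1 {1, 2} 2 {1, 2}" by (auto simp: out_in_config_def two)
  from out_in_prob_eq_N_p[OF p this]
  have "N_p p 2 2 2 0 = oprob p (arcs_on {1..2 :: nat}) (clusters 1 {1, 2} 2 {1, 2})"
    by (simp add: out_in_prob_eq_oprob[OF p])
  also have "\<dots> = oprob p (arcs_on {1..2 :: nat}) (\<lambda>G. True \<and> \<not> G \<inter> {(1, 2)} = {})"
    by (rule oprob_cong) (use clusters_two(1) in simp)
  also have "\<dots> = oprob p (arcs_on {1..2 :: nat}) (\<lambda>G. True) - oprob p (arcs_on {1..2 :: nat}) (\<lambda>G. True \<and> G \<inter> {(1, 2)} = {})"
    by (rule oprob_diff) (simp add: arcs_on_def)
  also have "\<dots> = p / 2"
    using oprob_two_avoid oprob_True[OF arc_set_arcs_on[of "{1..2 :: nat}"], of p] by simp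
  finally show "N_p p 2 2 2 0 = p / 2" .
  have "out_in_config 2 1 1 0 1 {1} 2 {2}" by (auto simp: out_in_config_def two)
  from out_in_prob_eq_N_p[OF p this]
  have "N_p p 2 1 1 0 = oprob p (arcs_on {1..2 :: nat}) (clusters 1 {1} 2 {2})"
    by (simp add: out_in_prob_eq_oprob[OF p])
  also have "\<dots> = oprob p (arcs_on {1..2 :: nat}) (\<lambda>G. G \<inter> {(1, 2)} = {})"
    by (rule oprob_cong) (use clusters_two(2) in simp)
  finally show "N_p p 2 1 1 0 = 1 - p / 2" using oprob_two_avoid by simp
qed

text \<open>The contrapositive of \<open>clusters_imp_config\<close>, justifying the last conjunct
  of \<open>out_in_config\<close>: the shapes it excludes are impossible events.\<close>

lemma out_in_prob_eq_0:
  assumes "A \<inter> T \<noteq> {}" "\<not> (a \<in> A \<inter> T \<and> t \<in> A \<inter> T)" "a \<noteq> t" "t \<in> {1..n}" "a \<in> {1..n}"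
  shows "out_in_prob p n t T a A = 0"
proof -
  have "out_in_prob p n t T a A = oprob p (arcs_on {1..n}) (\<lambda>G. False)"
    unfolding out_in_prob_eq_oprob[OF p]
  proof (rule oprob_cong)
    fix G :: "(nat \<times> nat) set" assume "G \<in> orientations (arcs_on {1..n})"
    then show "clusters t T a A G = False"
      using clusters_imp_config[OF _ arcs_onD, of t T a A G "{1..n}"] assms by (auto simp: config_def)
  qed
  then show ?thesis by (simp add: oprob_False)
qed

end

theorem theorem5p2:
  fixes p x y q :: real
  assumes "0 \<le> p" and "p \<le> 1"
    and "x = p / 2" and "y = 1 - p / 2" and "q = 1 - p"
  shows
    "(\<forall>n k s S. out_config n k s S \<longrightarrow> out_prob p n s S = d_p p n k) \<and>
     (\<forall>n \<tau> \<alpha> r t T a A. out_in_config n \<tau> \<alpha> r t T a A \<longrightarrow>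
        out_in_prob p n t T a A = N_p p n \<tau> \<alpha> r) \<and>
     (\<forall>n t T a A. a \<noteq> t \<and> t \<in> T \<and> T \<subseteq> {1..n} \<and> a \<in> A \<and> A \<subseteq> {1..n} \<and>
        A \<inter> T \<noteq> {} \<and> \<not> (a \<in> A \<inter> T \<and> t \<in> A \<inter> T) \<longrightarrow> out_in_prob p n t T a A = 0) \<and>
     d_p p 1 1 = 1 \<and> N_p p 2 2 2 0 = x \<and> N_p p 2 1 1 0 = y \<and>
     (\<forall>n \<tau> \<alpha> r. n \<ge> 2 \<and> \<tau> \<ge> 1 \<and> \<alpha> \<ge> 1 \<and> r \<le> n \<and> \<tau> + \<alpha> \<ge> n - r \<and> n - r \<ge> \<tau> \<and> n - r \<ge> \<alpha> \<and> r > 0 \<longrightarrow>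
        N_p p n \<tau> \<alpha> r =
          N_p p (n - r) \<tau> \<alpha> 0 * q ^ (r * (r + \<tau> + \<alpha> - n)) * y ^ (r * (2 * n - 2 * r - \<tau> - \<alpha>))) \<and>
     (\<forall>n \<tau> \<alpha> r. n \<ge> 2 \<and> \<tau> \<ge> 1 \<and> \<alpha> \<ge> 1 \<and> r \<le> n \<and> \<tau> + \<alpha> \<ge> n - r \<and> n - r \<ge> \<tau> \<and> n - r \<ge> \<alpha> \<longrightarrow>
        N_p p n \<tau> \<alpha> r = N_p p n \<alpha> \<tau> r) \<and>
     (\<forall>n \<tau> \<alpha>. \<tau> \<ge> 1 \<and> n > \<tau> \<and> n \<ge> \<alpha> \<and> \<alpha> \<ge> 2 \<and> \<tau> + \<alpha> \<ge> n + 2 \<longrightarrow>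
        N_p p n \<tau> \<alpha> 0 =
          (\<Sum>\<zeta>=1..n - \<tau>. real ((n - \<tau> - 1) choose (\<zeta> - 1)) * N_p p (n - \<zeta>) \<tau> (\<alpha> - \<zeta>) 0 * d_p p \<zeta> \<zeta> *
             q ^ ((\<zeta> - 1) * (\<alpha> + \<tau> - n)) * y ^ ((\<zeta> - 1) * (2 * n - \<tau> - \<alpha> - \<zeta>)) *
             (y ^ \<tau> - y ^ (2 * n - \<alpha> - \<tau> - \<zeta>) * q ^ (\<alpha> + \<tau> - n)))) \<and>
     (\<forall>n \<tau> \<alpha>. \<tau> \<ge> 1 \<and> \<alpha> \<ge> 2 \<and> n = \<tau> + \<alpha> \<longrightarrow>
        N_p p n \<tau> \<alpha> 0 =
          (\<Sum>\<zeta>=1..\<alpha> - 1. real ((\<alpha> - 2) choose (\<zeta> - 1)) * N_p p (n - \<zeta>) \<tau> (\<alpha> - \<zeta>) 0 * d_p p \<zeta> \<zeta> *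
             y ^ ((\<zeta> - 1) * (\<tau> + \<alpha> - \<zeta>)) * y ^ \<tau> * (1 - y ^ (\<alpha> - \<zeta>)))) \<and>
     (\<forall>n\<ge>2. N_p p n n n 0 =
        1 - (\<Sum>j=2..n - 1. real ((n - 2) choose (j - 2)) *
               (\<Sum>\<tau>=j..n. real ((n - j) choose (\<tau> - j)) *
                 (\<Sum>\<alpha>=j..n - \<tau> + j. real ((n - \<tau>) choose (\<alpha> - j)) * N_p p n \<tau> \<alpha> (n + j - \<alpha> - \<tau>))))
          - (\<Sum>\<tau>=1..n. real ((n - 2) choose (\<tau> - 1)) *
               (\<Sum>\<alpha>=1..n - \<tau>. real ((n - \<tau> - 1) choose (\<alpha> - 1)) * N_p p n \<tau> \<alpha> (n - \<alpha> - \<tau>))))"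
proof -
  note p = assms(1,2)
  have y: "y = 1 - p / 2" and q: "q = 1 - p" and x: "x = p / 2" using assms by auto
  show ?thesis
    unfolding x y q
  proof (intro conjI allI impI, goal_cases)
    case 1 then show ?case by (rule out_prob_eq_d_p[OF p])
  next
    case 2 then show ?case by (rule out_in_prob_eq_N_p[OF p])
  next
    case 3 then show ?case by (intro out_in_prob_eq_0[OF p]) blast+
  next
    case 4 show ?case by (rule d_p_1_1[OF p])
  next
    case 5 show ?case by (rule N_p_two(1)[OF p])
  next
    case 6 show ?case by (rule N_p_two(2)[OF p])
  next
    case 7 then show ?case by (intro N_p_reduce[OF p]) linarith+
  next
    case 8 show ?case by (rule N_p_swap[OF p])
  next
    case 9 then show ?case by (intro N_p_recursion_meet[OF p]) linarith+
  next
    case 10 then show ?case by (intro N_p_recursion_disjoint[OF p]) linarith+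
  next
    case 11 then show ?case by (rule N_p_full[OF p])
  qed
qed

end
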